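(* Let $\mathbb{F}$ be a field with $\mathrm{Char}(\mathbb{F})\neq2,3$ in which every quadratic and every cubic polynomial has a root. The number of nontrivial (that is, one-dimensional) two-sided ideals of the algebras $A_1,\dots,A_{12}$ of the context (parameters in $\mathbb{F}$) is as follows. - $A_1(\alpha_1,\alpha_2,\alpha_4,\beta_1)$: no ideal if $\alpha_4\neq-\alpha_1-2\alpha_2$ or $\beta_1\neq2\alpha_1+\alpha_2$; one ideal if $\alpha_4=-\alpha_1-2\alpha_2$ and $\beta_1=2\alpha_1+\alpha_2$. - $A_2(\alpha_1,\beta_1,\beta_2)$: no ideal if one of the following holds: ($\alpha_1=1$, $\beta_1\neq0$, $\beta_2=0$); ($\alpha_1\neq\frac12,1$, $\beta_1^2+\alpha_1-1\neq0$, $\beta_2=1-\alpha_1$); ($\alpha_1=\beta_2=\frac12$, $\beta_1\neq0$); $\beta_2\neq1-\alpha_1$. One ideal if ($\alpha_1=1$, $\beta_1=\beta_2=0$) or ($\alpha_1\neq\frac12,1$, $\beta_2=1-\alpha_1$, $\beta_1^2+\alpha_1-1=0$). Two ideals if $\alpha_1=\beta_2=\frac12$, $\beta_1=0$. - $A_3(\beta_1,\beta_2)$: no ideal if ($\beta_1\neq-\frac14$ and $\beta_2=1$) or $\beta_2\neq1$; one ideal if $\beta_1=-\frac14$, $\beta_2=1$. - $A_4(\alpha_1,\beta_2)$: one ideal if ($\alpha_1\neq1$ and $\beta_2=1-\alpha_1$) or $\beta_2\neq1-\alpha_1$; two ideals if $\alpha_1=1$, $\beta_2=0$. - $A_5(\alpha_1)$,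 $A_8(\alpha_1)$, $A_9$, $A_{10}$, $A_{12}$: one ideal, for all values of the parameters. - $A_6(\alpha_1,\beta_1)$, $A_7(\beta_1)$, $A_{11}$: no ideal, for all values of the parameters. In particular, the algebras listed with no ideal give the classification, up to isomorphism, of all simple two-dimensional algebras over $\mathbb{F}$.
   Context: An algebra is a vector space with a bilinear product (not necessarily associative, commutative or unital); it is nontrivial if its product is not identically zero, and only nontrivial algebras are considered. An algebra is called simple if it has no nontrivial two-sided ideal; a nontrivial two-sided ideal of a two-dimensional algebra $\mathbb{A}$ is a one-dimensional subspace $\mathbb{F}\mathbf u$ with $\mathbf v\mathbf u,\mathbf u\mathbf v\in\mathbb{F}\mathbf u$ for all $\mathbf v\in\mathbb{A}$. A two-dimensional algebra with basis $e_1,e_2$ is identified with its matrix of structure constants (MSC) $A=\begin{pmatrix}\alpha_1&\alpha_2&\alpha_3&\alpha_4\\ \beta_1&\beta_2&\beta_3&\beta_4\end{pmatrix}$, meaning $e_1e_1=\alpha_1e_1+\beta_1e_2$, $e_1e_2=\alpha_2e_1+\beta_2e_2$, $e_2e_1=\alpha_3e_1+\beta_3e_2$, $e_2e_2=\alpha_4e_1+\beta_4e_2$. Families ($\mathrm{Char}(\mathbb{F})\ne2,3$); it is known from earlier work that every nontrivial two-dimensional algebra over $\mathbb{F}$ is isomorphic to only one of these, up to $A_2(\alpha_1,\beta_1,\beta_2)\simeq A_2(\alpha_1,-\beta_1,\beta_2)$ and $A_6(\alpha_1,\beta_1)\simeq A_6(\alpha_1,-\beta_1)$: $A_1(\alpha_1,\alpha_2,\alpha_4,\beta_1)=\begin{pmatrix}\alpha_1&\alpha_2&\alpha_2+1&\alpha_4\\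 \beta_1&-\alpha_1&-\alpha_1+1&-\alpha_2\end{pmatrix}$, $A_2(\alpha_1,\beta_1,\beta_2)=\begin{pmatrix}\alpha_1&0&0&1\\ \beta_1&\beta_2&1-\alpha_1&0\end{pmatrix}$, $A_3(\beta_1,\beta_2)=\begin{pmatrix}0&1&1&0\\ \beta_1&\beta_2&1&-1\end{pmatrix}$, $A_4(\alpha_1,\beta_2)=\begin{pmatrix}\alpha_1&0&0&0\\ 0&\beta_2&1-\alpha_1&0\end{pmatrix}$, $A_5(\alpha_1)=\begin{pmatrix}\alpha_1&0&0&0\\ 1&2\alpha_1-1&1-\alpha_1&0\end{pmatrix}$, $A_6(\alpha_1,\beta_1)=\begin{pmatrix}\alpha_1&0&0&1\\ \beta_1&1-\alpha_1&-\alpha_1&0\end{pmatrix}$, $A_7(\beta_1)=\begin{pmatrix}0&1&1&0\\ \beta_1&1&0&-1\end{pmatrix}$, $A_8(\alpha_1)=\begin{pmatrix}\alpha_1&0&0&0\\ 0&1-\alpha_1&-\alpha_1&0\end{pmatrix}$, $A_9=\begin{pmatrix}\frac13&0&0&0\\ 1&\frac23&-\frac13&0\end{pmatrix}$, $A_{10}=\begin{pmatrix}0&1&1&0\\ 0&0&0&-1\end{pmatrix}$, $A_{11}=\begin{pmatrix}0&1&1&0\\ 1&0&0&-1\end{pmatrix}$, $A_{12}=\begin{pmatrix}0&0&0&0\\ 1&0&0&0\end{pmatrix}$.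
   Formalization: For A_2 with α1≠1/2,1 and β2=1−α1, the expression β1²+α1−1 is corrected to β1²+(α1−1)(2α1−1)² in both the "no ideal" and "one ideal" cases; as printed it fails, e.g. α1=2, β2=−1, β1²=−1 has no ideal. *)

theory Defs
  imports "HOL-Analysis.Analysis" "HOL-Computational_Algebra.Polynomial"
begin

subsection \<open>Two-dimensional algebras\<close>

text \<open>An algebra is given by its scalar multiplication \<open>s\<close> and its product \<open>m\<close>; the carrier is the
  whole type.  The library dimension of an infinite-dimensional space is 0, so dimension 2 includes
  finite-dimensionality.\<close>

definition two_dim_algebra ::
    "('a::field \<Rightarrow> 'v::ab_group_add \<Rightarrow> 'v) \<Rightarrow> ('v \<Rightarrow> 'v \<Rightarrow> 'v) \<Rightarrow> bool" where
  "two_dim_algebra s m \<longleftrightarrow>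
     vector_space s \<and> vector_space.dim s UNIV = 2 \<and>
     (\<forall>x. Vector_Spaces.linear s s (\<lambda>y. m x y)) \<and>
     (\<forall>y. Vector_Spaces.linear s s (\<lambda>x. m x y))"

definition nontrivial_ideals ::
    "('a::field \<Rightarrow> 'v::ab_group_add \<Rightarrow> 'v) \<Rightarrow> ('v \<Rightarrow> 'v \<Rightarrow> 'v) \<Rightarrow> 'v set set" where
  "nontrivial_ideals s m =
     {I. \<exists>u. u \<noteq> 0 \<and> I = module.span s {u} \<and> (\<forall>v. m v u \<in> I \<and> m u v \<in> I)}"

definition simple_algebra ::
    "('a::field \<Rightarrow> 'v::ab_group_add \<Rightarrow> 'v) \<Rightarrow> ('v \<Rightarrow> 'v \<Rightarrow> 'v) \<Rightarrow> bool" where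
  "simple_algebra s m \<longleftrightarrow>
     two_dim_algebra s m \<and> (\<exists>x y. m x y \<noteq> 0) \<and> nontrivial_ideals s m = {}"

definition isomorphic_algebras ::
    "('a::field \<Rightarrow> 'v::ab_group_add \<Rightarrow> 'v) \<Rightarrow> ('v \<Rightarrow> 'v \<Rightarrow> 'v) \<Rightarrow>
     ('a \<Rightarrow> 'w::ab_group_add \<Rightarrow> 'w) \<Rightarrow> ('w \<Rightarrow> 'w \<Rightarrow> 'w) \<Rightarrow> bool" where
  "isomorphic_algebras s m s' m' \<longleftrightarrow>
     (\<exists>f. Vector_Spaces.linear s s' f \<and> bij f \<and> (\<forall>x y. f (m x y) = m' (f x) (f y)))"

subsection \<open>Matrices of structure constants\<close>

text \<open>Column \<open>2 * (i - 1) + j\<close> holds the coordinates of \<open>e\<^sub>i e\<^sub>j\<close> in the standard basis.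
  The column index 4 is the element \<open>4 = 0\<close> of the four-element index type.\<close>

definition msc_prod :: "'a::field^4^2 \<Rightarrow> 'a^2 \<Rightarrow> 'a^2 \<Rightarrow> 'a^2" where
  "msc_prod A x y =
     (\<chi> k. A $ k $ 1 * x $ 1 * y $ 1 + A $ k $ 2 * x $ 1 * y $ 2
         + A $ k $ 3 * x $ 2 * y $ 1 + A $ k $ 4 * x $ 2 * y $ 2)"

abbreviation msc_ideals :: "'a::field^4^2 \<Rightarrow> ('a^2) set set" where
  "msc_ideals A \<equiv> nontrivial_ideals (*s) (msc_prod A)"

definition A1 :: "'a::field \<Rightarrow> 'a \<Rightarrow> 'a \<Rightarrow> 'a \<Rightarrow> 'a^4^2" where
  "A1 \<alpha>1 \<alpha>2 \<alpha>4 \<beta>1 = vector [vector [\<alpha>1, \<alpha>2, \<alpha>2 + 1, \<alpha>4], vector [\<beta>1, - \<alpha>1, - \<alpha>1 + 1, - \<alpha>2]]"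
definition A2 :: "'a::field \<Rightarrow> 'a \<Rightarrow> 'a \<Rightarrow> 'a^4^2" where
  "A2 \<alpha>1 \<beta>1 \<beta>2 = vector [vector [\<alpha>1, 0, 0, 1], vector [\<beta>1, \<beta>2, 1 - \<alpha>1, 0]]"
definition A3 :: "'a::field \<Rightarrow> 'a \<Rightarrow> 'a^4^2" where
  "A3 \<beta>1 \<beta>2 = vector [vector [0, 1, 1, 0], vector [\<beta>1, \<beta>2, 1, - 1]]"
definition A4 :: "'a::field \<Rightarrow> 'a \<Rightarrow> 'a^4^2" where
  "A4 \<alpha>1 \<beta>2 = vector [vector [\<alpha>1, 0, 0, 0], vector [0, \<beta>2, 1 - \<alpha>1, 0]]"
definition A5 :: "'a::field \<Rightarrow> 'a^4^2" where
  "A5 \<alpha>1 = vector [vector [\<alpha>1, 0, 0, 0], vector [1, 2 * \<alpha>1 - 1, 1 - \<alpha>1, 0]]"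
definition A6 :: "'a::field \<Rightarrow> 'a \<Rightarrow> 'a^4^2" where
  "A6 \<alpha>1 \<beta>1 = vector [vector [\<alpha>1, 0, 0, 1], vector [\<beta>1, 1 - \<alpha>1, - \<alpha>1, 0]]"
definition A7 :: "'a::field \<Rightarrow> 'a^4^2" where
  "A7 \<beta>1 = vector [vector [0, 1, 1, 0], vector [\<beta>1, 1, 0, - 1]]"
definition A8 :: "'a::field \<Rightarrow> 'a^4^2" where
  "A8 \<alpha>1 = vector [vector [\<alpha>1, 0, 0, 0], vector [0, 1 - \<alpha>1, - \<alpha>1, 0]]"
definition A9 :: "'a::field^4^2" where
  "A9 = vector [vector [1 / 3, 0, 0, 0], vector [1, 2 / 3, - (1 / 3), 0]]"
definition A10 :: "'a::field^4^2" where
  "A10 = vector [vector [0, 1, 1, 0], vector [0, 0, 0, - 1]]"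
definition A11 :: "'a::field^4^2" where
  "A11 = vector [vector [0, 1, 1, 0], vector [1, 0, 0, - 1]]"
definition A12 :: "'a::field^4^2" where
  "A12 = vector [vector [0, 0, 0, 0], vector [1, 0, 0, 0]]"

subsection \<open>The ideal-free algebras of the list\<close>

text \<open>Erratum in the second rule for \<open>A2\<close>: the source prints \<open>\<beta>1\<^sup>2 + \<alpha>1 - 1\<close>.  If \<open>\<beta>2 = 1 - \<alpha>1\<close>, the span
  of \<open>e\<^sub>1 + y e\<^sub>2\<close> is an ideal iff \<open>y\<^sup>2 = 1 - \<alpha>1\<close> and \<open>(2\<alpha>1 - 1) y = \<beta>1\<close>; for \<open>\<alpha>1 \<noteq> 1/2\<close> such a \<open>y\<close>
  exists iff \<open>\<beta>1\<^sup>2 + (\<alpha>1 - 1) (2\<alpha>1 - 1)\<^sup>2 = 0\<close>.  The printed expression omits the factor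
  \<open>(2\<alpha>1 - 1)\<^sup>2\<close>; the printed count is false, e.g. for \<open>\<alpha>1 = 2\<close>, \<open>\<beta>2 = -1\<close>, \<open>\<beta>1\<^sup>2 = -1\<close> (no ideal).\<close>

inductive ideal_free :: "'a::field^4^2 \<Rightarrow> bool" where
  "\<alpha>4 \<noteq> - \<alpha>1 - 2 * \<alpha>2 \<or> \<beta>1 \<noteq> 2 * \<alpha>1 + \<alpha>2 \<Longrightarrow> ideal_free (A1 \<alpha>1 \<alpha>2 \<alpha>4 \<beta>1)"
| "\<alpha>1 = 1 \<Longrightarrow> \<beta>1 \<noteq> 0 \<Longrightarrow> \<beta>2 = 0 \<Longrightarrow> ideal_free (A2 \<alpha>1 \<beta>1 \<beta>2)"
| "\<alpha>1 \<noteq> 1 / 2 \<Longrightarrow> \<alpha>1 \<noteq> 1 \<Longrightarrow> \<beta>1\<^sup>2 + (\<alpha>1 - 1) * (2 * \<alpha>1 - 1)\<^sup>2 \<noteq> 0 \<Longrightarrow> \<beta>2 = 1 - \<alpha>1 \<Longrightarrow>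
     ideal_free (A2 \<alpha>1 \<beta>1 \<beta>2)"
| "\<alpha>1 = 1 / 2 \<Longrightarrow> \<beta>2 = 1 / 2 \<Longrightarrow> \<beta>1 \<noteq> 0 \<Longrightarrow> ideal_free (A2 \<alpha>1 \<beta>1 \<beta>2)"
| "\<beta>2 \<noteq> 1 - \<alpha>1 \<Longrightarrow> ideal_free (A2 \<alpha>1 \<beta>1 \<beta>2)"
| "(\<beta>1 \<noteq> - (1 / 4) \<and> \<beta>2 = 1) \<or> \<beta>2 \<noteq> 1 \<Longrightarrow> ideal_free (A3 \<beta>1 \<beta>2)"
| "ideal_free (A6 \<alpha>1 \<beta>1)"
| "ideal_free (A7 \<beta>1)"
| "ideal_free A11"

inductive same_up_to_sign :: "'a::field^4^2 \<Rightarrow> 'a^4^2 \<Rightarrow> bool" where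
  "same_up_to_sign A A"
| "same_up_to_sign (A2 \<alpha>1 \<beta>1 \<beta>2) (A2 \<alpha>1 (- \<beta>1) \<beta>2)"
| "same_up_to_sign (A6 \<alpha>1 \<beta>1) (A6 \<alpha>1 (- \<beta>1))"

end

(*
  The span of u is an ideal iff the four products e_i u, u e_i are multiples of u.  In coordinates
  these are quadratic equations, which are solved family by family.

  The traces of left and right multiplication are two linear forms that every isomorphism
  respects.  If they are independent, their dual basis is canonical and gives A1.  If they
  are dependent but not both zero, normalise the coordinates so that e_2 spans their common kernel:
  either e_2 e_2 leaves the line of e_2 (A2, A6), or it is a nonzero multiple of e_2 (A3, A7), or it
  vanishes and that line is an ideal.  If both vanish, a root of a cubic yields a vector u
  with u u in the line of u, and the only ideal-free algebra is A11.  In the first two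
  cases the normalisation leaves at most the sign of e_2 free, which gives uniqueness.
*)
theory Submission
  imports Defs
begin

text \<open>An isomorphism conjugates multiplication by \<open>u\<close> into multiplication by the
  image of \<open>u\<close>, so the traces are fixed before any product is compared. The right trace
  takes precedence: if the traces are dependent, it is scaled to 1 on \<open>e_1\<close> unless it
  vanishes (\<open>A2\<close>, \<open>A3\<close>), and the left trace is scaled only if the right
  one is zero (\<open>A6\<close>, \<open>A7\<close>). Roots of quadratics enter because rescaling
  one basis vector alone changes a structure constant by a square, and because the slope of an ideal
  of \<open>A2\<close> is a square root. Division by 2 removes the \<open>e_1\<close>-coordinate of
  \<open>e_1 e_1\<close> when \<open>e_2 e_2\<close> is a nonzero multiple of \<open>e_2\<close>.
  With zero traces no line is distinguished, which is why a line containing its own square has to be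
  found by a cubic. For the ideals of the given families the guiding fact is that
  \<open>v u - u v\<close> is alternating, hence a multiple of \<open>e_2 e_1 - e_1 e_2\<close>.
  Every ideal contains this vector; if it is nonzero, its line is the only candidate.\<close>

lemma vector_4 [simp]:
  "(vector [a, b, c, d] :: 'a::zero^4) $ 1 = a"
  "(vector [a, b, c, d] :: 'a::zero^4) $ 2 = b"
  "(vector [a, b, c, d] :: 'a::zero^4) $ 3 = c"
  "(vector [a, b, c, d] :: 'a::zero^4) $ 4 = d"
  unfolding vector_def by simp_all

lemma vec2_eq_iff: "x = y \<longleftrightarrow> x $ 1 = y $ 1 \<and> x $ 2 = y $ 2" for x y :: "'a^2"
  by (simp add: vec_eq_iff forall_2)

lemma vec2_cases:
  fixes u :: "'a::zero^2"
  obtains x y where "u = vector [x, y]"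
proof
  show "u = vector [u $ 1, u $ 2]"
    by (simp add: vec2_eq_iff)
qed

lemma msc_rows [simp]:
  "A1 a b c d $ 1 = vector [a, b, b + 1, c]" "A1 a b c d $ 2 = vector [d, - a, - a + 1, - b]"
  "A2 a d e $ 1 = vector [a, 0, 0, 1]" "A2 a d e $ 2 = vector [d, e, 1 - a, 0]"
  "A3 d e $ 1 = vector [0, 1, 1, 0]" "A3 d e $ 2 = vector [d, e, 1, - 1]"
  "A4 a e $ 1 = vector [a, 0, 0, 0]" "A4 a e $ 2 = vector [0, e, 1 - a, 0]"
  "A5 a $ 1 = vector [a, 0, 0, 0]" "A5 a $ 2 = vector [1, 2 * a - 1, 1 - a, 0]"
  "A6 a d $ 1 = vector [a, 0, 0, 1]" "A6 a d $ 2 = vector [d, 1 - a, - a, 0]"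
  "A7 d $ 1 = vector [0, 1, 1, 0]" "A7 d $ 2 = vector [d, 1, 0, - 1]"
  "A8 a $ 1 = vector [a, 0, 0, 0]" "A8 a $ 2 = vector [0, 1 - a, - a, 0]"
  "A9 $ 1 = vector [1 / 3, 0, 0, 0]" "A9 $ 2 = vector [1, 2 / 3, - (1 / 3), 0]"
  "A10 $ 1 = vector [0, 1, 1, 0]" "A10 $ 2 = vector [0, 0, 0, - 1]"
  "A11 $ 1 = vector [0, 1, 1, 0]" "A11 $ 2 = vector [1, 0, 0, - 1]"
  "A12 $ 1 = vector [0, 0, 0, 0]" "A12 $ 2 = vector [1, 0, 0, 0]"
  by (simp_all add: A1_def A2_def A3_def A4_def A5_def A6_def A7_def A8_def A9_def A10_def
      A11_def A12_def)

section \<open>Ideals of a matrix of structure constants\<close>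

text \<open>A vanishing determinant expresses that \<open>v\<close> lies in the line of
  \<open>u\<close>, without naming the scalar; ideals become polynomial equations.\<close>

lemma mem_span_vec2:
  fixes u v :: "'a::field^2"
  assumes "u \<noteq> 0"
  shows "v \<in> module.span (*s) {u} \<longleftrightarrow> u $ 1 * v $ 2 = u $ 2 * v $ 1"
proof
  assume "v \<in> module.span (*s) {u}"
  then show "u $ 1 * v $ 2 = u $ 2 * v $ 1"
    by (auto simp: vec.span_singleton)
next
  assume eq: "u $ 1 * v $ 2 = u $ 2 * v $ 1"
  show "v \<in> module.span (*s) {u}"
  proof (cases "u $ 1 = 0")
    case True
    with assms have "u $ 2 \<noteq> 0" by (simp add: vec2_eq_iff)
    with True eq have "v = (v $ 2 / u $ 2) *s u" by (simp add: vec2_eq_iff)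
    then show ?thesis unfolding vec.span_singleton by blast
  next
    case False
    with eq have "v = (v $ 1 / u $ 1) *s u" by (simp add: vec2_eq_iff field_simps)
    then show ?thesis unfolding vec.span_singleton by blast
  qed
qed

lemma span_vec2_eq_iff:
  fixes u v :: "'a::field^2"
  assumes "u \<noteq> 0" "v \<noteq> 0"
  shows "module.span (*s) {u} = module.span (*s) {v} \<longleftrightarrow> u $ 1 * v $ 2 = u $ 2 * v $ 1"
proof
  assume "module.span (*s) {u} = module.span (*s) {v}"
  then have "v \<in> module.span (*s) {u}" by (simp add: vec.span_base)
  then show "u $ 1 * v $ 2 = u $ 2 * v $ 1" by (simp add: mem_span_vec2[OF assms(1)])
next
  assume "u $ 1 * v $ 2 = u $ 2 * v $ 1"
  then have "v \<in> module.span (*s) {u}" "u \<in> module.span (*s) {v}"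
    by (simp_all add: mem_span_vec2 assms mult.commute)
  then show "module.span (*s) {u} = module.span (*s) {v}"
    by (simp add: vec.span_eq)
qed

text \<open>The four equations say that \<open>e\<^sub>1 u\<close>, \<open>u e\<^sub>1\<close>, \<open>e\<^sub>2 u\<close>, \<open>u e\<^sub>2\<close> are multiples of
  \<open>u = x e\<^sub>1 + y e\<^sub>2\<close>.\<close>

definition spans_ideal :: "'a::field^4^2 \<Rightarrow> 'a \<Rightarrow> 'a \<Rightarrow> bool" where
  "spans_ideal A x y \<longleftrightarrow> (x \<noteq> 0 \<or> y \<noteq> 0) \<and>
     x * (A $ 2 $ 1 * x + A $ 2 $ 2 * y) = y * (A $ 1 $ 1 * x + A $ 1 $ 2 * y) \<and>
     x * (A $ 2 $ 1 * x + A $ 2 $ 3 * y) = y * (A $ 1 $ 1 * x + A $ 1 $ 3 * y) \<and>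
     x * (A $ 2 $ 3 * x + A $ 2 $ 4 * y) = y * (A $ 1 $ 3 * x + A $ 1 $ 4 * y) \<and>
     x * (A $ 2 $ 2 * x + A $ 2 $ 4 * y) = y * (A $ 1 $ 2 * x + A $ 1 $ 4 * y)"

text \<open>Both products are linear in \<open>v\<close>, so testing \<open>v\<close> at the two
  basis vectors suffices.\<close>

lemma spans_ideal_iff:
  fixes u :: "'a::field^2"
  shows "spans_ideal A (u $ 1) (u $ 2) \<longleftrightarrow> u \<noteq> 0 \<and>
    (\<forall>v. msc_prod A v u \<in> module.span (*s) {u} \<and> msc_prod A u v \<in> module.span (*s) {u})"
    (is "?l \<longleftrightarrow> ?r")
proof
  assume l: ?l
  then have u: "u \<noteq> 0" by (auto simp: spans_ideal_def)
  have "msc_prod A v u \<in> module.span (*s) {u} \<and> msc_prod A u v \<in> module.span (*s) {u}" for v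
    using l unfolding mem_span_vec2[OF u] spans_ideal_def msc_prod_def by simp algebra
  with u show ?r by blast
next
  assume r: ?r
  then have u: "u \<noteq> 0" by blast
  have *: "u $ 1 * msc_prod A v u $ 2 = u $ 2 * msc_prod A v u $ 1 \<and>
      u $ 1 * msc_prod A u v $ 2 = u $ 2 * msc_prod A u v $ 1" for v
    using r mem_span_vec2[OF u] by blast
  show ?l
    using *[of "vector [1, 0]"] *[of "vector [0, 1]"] u
    by (simp add: spans_ideal_def msc_prod_def vec2_eq_iff)
qed

lemma msc_ideals_eq:
  "msc_ideals A = {module.span (*s) {vector [x, y]} |x y. spans_ideal A x y}"
proof -
  have "msc_ideals A = {module.span (*s) {u} |u. spans_ideal A (u $ 1) (u $ 2)}"
    unfolding nontrivial_ideals_def spans_ideal_iff by blast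
  also have "\<dots> = {module.span (*s) {vector [x, y]} |x y. spans_ideal A x y}"
    by (smt (verit) Collect_cong vec2_cases vector_2)
  finally show ?thesis .
qed

lemma msc_ideals_empty_iff: "msc_ideals A = {} \<longleftrightarrow> (\<forall>x y. \<not> spans_ideal A x y)"
  unfolding msc_ideals_eq by auto

lemma spans_ideal_nonzero: "spans_ideal A x y \<Longrightarrow> (vector [x, y] :: 'a::field^2) \<noteq> 0"
  by (auto simp: spans_ideal_def vec2_eq_iff)

text \<open>An ideal is a point of the projective line with homogeneous coordinates
  \<open>x\<close>, \<open>y\<close>; cross products compare such points without a case split on
  which coordinate is nonzero.\<close>

lemma card_msc_ideals_1:
  assumes "spans_ideal A x0 y0"
    and "\<And>x y. spans_ideal A x y \<Longrightarrow> x * y0 = y * x0"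
  shows "card (msc_ideals A) = 1"
proof -
  have "msc_ideals A = {module.span (*s) {vector [x0, y0]}}"
  proof -
    have "module.span (*s) {vector [x, y] :: 'a^2} = module.span (*s) {vector [x0, y0]}"
      if "spans_ideal A x y" for x y
      using assms(2)[OF that] that assms(1) by (simp add: span_vec2_eq_iff spans_ideal_nonzero)
    with assms(1) show ?thesis unfolding msc_ideals_eq by blast
  qed
  then show ?thesis by simp
qed

lemma card_msc_ideals_2:
  assumes "spans_ideal A x0 y0" "spans_ideal A x1 y1" "x0 * y1 \<noteq> y0 * x1"
    and "\<And>x y. spans_ideal A x y \<Longrightarrow> x * y0 = y * x0 \<or> x * y1 = y * x1"
  shows "card (msc_ideals A) = 2"
proof -
  have "msc_ideals A = {module.span (*s) {vector [x0, y0]}, module.span (*s) {vector [x1, y1]}}"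
  proof -
    have "module.span (*s) {vector [x, y] :: 'a^2} = module.span (*s) {vector [x0, y0]} \<or>
        module.span (*s) {vector [x, y] :: 'a^2} = module.span (*s) {vector [x1, y1]}"
      if "spans_ideal A x y" for x y
      using assms(4)[OF that] that assms(1,2)
      by (simp add: span_vec2_eq_iff spans_ideal_nonzero)
    with assms(1,2) show ?thesis unfolding msc_ideals_eq by blast
  qed
  moreover have "module.span (*s) {vector [x0, y0] :: 'a^2} \<noteq> module.span (*s) {vector [x1, y1]}"
    using assms by (simp add: span_vec2_eq_iff spans_ideal_nonzero)
  ultimately show ?thesis by simp
qed

section \<open>Ideal equations of the twelve families\<close>

lemma spans_ideal_A1:
  "spans_ideal (A1 a b c d) x y \<longleftrightarrow> x \<noteq> 0 \<and> x = y \<and> c = - a - 2 * b \<and> d = 2 * a + b"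
  (is "?l \<longleftrightarrow> ?r")
proof
  assume l: ?l
  \<comment> \<open>In \<open>A1\<close> the commutator \<open>e_2 e_1 - e_1 e_2\<close> is
    \<open>e_1 + e_2\<close>, so \<open>u\<close> must be a multiple of it. The two equations are
    differences of the conditions for \<open>e_i u\<close> and \<open>u e_i\<close>.\<close>
  then have "x * (x - y) = 0" "y * (x - y) = 0"
    by (simp_all add: spans_ideal_def, algebra+)
  with l have xy: "x = y" "x \<noteq> 0" by (auto simp: spans_ideal_def)
  with l have "x * x * (d - (2 * a + b)) = 0" "x * x * (c - (- a - 2 * b)) = 0"
    by (simp_all add: spans_ideal_def, algebra+)
  with xy show ?r by simp
next
  assume ?r
  then have "y = x" "c = - a - 2 * b" "d = 2 * a + b" "x \<noteq> 0" by auto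
  then show ?l
    unfolding \<open>y = x\<close> \<open>c = - a - 2 * b\<close> \<open>d = 2 * a + b\<close>
    by (simp add: spans_ideal_def algebra_simps)
qed

text \<open>The commutator is \<open>(1 - a - c) e_2\<close>, and \<open>e_2 e_2 = e_1\<close> keeps
  the line of \<open>e_2\<close> from being an ideal; this forces \<open>c = 1 - a\<close>. What
  remains is one quadratic and one linear condition on the slope \<open>y / x\<close>.\<close>

lemma spans_ideal_A2:
  "spans_ideal (A2 a b c) x y \<longleftrightarrow>
    x \<noteq> 0 \<and> c = 1 - a \<and> y\<^sup>2 = (1 - a) * x\<^sup>2 \<and> b * x = (2 * a - 1) * y"
  (is "?l \<longleftrightarrow> ?r")
proof
  assume l: ?l
  then have x: "x \<noteq> 0" by (auto simp: spans_ideal_def)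
  have eqs: "x * (b * x + c * y) = y * (a * x)" "x * ((1 - a) * x) = y * y" "x * (c * x) = y * y"
    using l by (simp_all add: spans_ideal_def)
  then have "x * x * (c - (1 - a)) = 0" by algebra
  with x have c: "c = 1 - a" by simp
  have "x * (b * x - (2 * a - 1) * y) = 0" using eqs c by algebra
  with x have "b * x = (2 * a - 1) * y" by simp
  with x c eqs show ?r by (simp add: power2_eq_square algebra_simps)
next
  assume r: ?r
  then have "x * (b * x + c * y) = y * (a * x)" "x * (b * x + (1 - a) * y) = y * (a * x)"
    "x * ((1 - a) * x) = y * y" "x * (c * x) = y * y"
    by algebra+
  with r show ?l by (simp add: spans_ideal_def)
qed

lemma spans_ideal_A3:
  assumes "(2::'a::field) \<noteq> 0"
  shows "spans_ideal (A3 b c :: 'a^4^2) x y \<longleftrightarrow> y \<noteq> 0 \<and> x = 2 * y \<and> c = 1 \<and> b = - (1 / 4)"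
  (is "?l \<longleftrightarrow> ?r")
proof -
  have four: "(4::'a) \<noteq> 0"
    using assms no_zero_divisors[OF assms assms] by simp
  show ?thesis
  proof
    assume l: ?l
    then have eqs: "x * (b * x + c * y) = y * y" "x * (b * x + y) = y * y"
      "x * (x - y) = y * x" "x * (c * x - y) = y * x"
      by (simp_all add: spans_ideal_def)
    have x: "x \<noteq> 0" using l by (auto simp: spans_ideal_def)
    have "x * (x - 2 * y) = 0" "x * x * (c - 1) = 0" using eqs by algebra+
    with x have c: "x = 2 * y" "c = 1" by (metis mult_eq_0_iff right_minus_eq)+
    with x have y: "y \<noteq> 0" by auto
    have "y * y * (4 * b + 1) = 0" using eqs c by algebra
    with y have "4 * b + 1 = 0" by simp
    then have "b = - (1 / 4)" using four by (simp add: field_simps eq_neg_iff_add_eq_0)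
    with c y show ?r by simp
  next
    assume r: ?r
    \<comment> \<open>A name for the quarter with \<open>4 * k = 1\<close> keeps the following
      identities free of division.\<close>
    define k :: 'a where "k = 1 / 4"
    have k: "4 * k = 1" using four by (simp add: k_def)
    from r have "b = - k" "x = 2 * y" "c = 1" "x \<noteq> 0"
      using assms by (simp_all add: k_def)
    moreover have "x * (b * x + y) = y * y * (2 - 4 * k)"
      unfolding \<open>x = 2 * y\<close> \<open>b = - k\<close> by algebra
    then have "x * (b * x + y) = y * y" by (simp add: k)
    moreover have "x * (x - y) = y * x"
      using \<open>x = 2 * y\<close> by algebra
    ultimately show ?l by (simp add: spans_ideal_def)
  qed
qed

text \<open>The products \<open>e_2 u\<close> and \<open>u e_2\<close> are multiples of
  \<open>e_2\<close>. If \<open>u\<close> is not on that line they must vanish, which gives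
  \<open>a = 1\<close> and \<open>c = 0\<close>; then \<open>e_1 u\<close> is a multiple of
  \<open>e_1\<close>, so \<open>u\<close> is one too.\<close>

lemma spans_ideal_A4:
  "spans_ideal (A4 a c) x y \<longleftrightarrow>
    x = 0 \<and> y \<noteq> 0 \<or> x \<noteq> 0 \<and> c = 0 \<and> a = 1 \<and> y = 0"
  (is "?l \<longleftrightarrow> ?r")
proof
  assume l: ?l
  then have eqs: "x * (c * y) = y * (a * x)" "x * ((1 - a) * y) = y * (a * x)"
    "x * ((1 - a) * x) = 0" "x * (c * x) = 0"
    by (simp_all add: spans_ideal_def)
  with l show ?r by (auto simp: spans_ideal_def)
next
  assume ?r then show ?l by (auto simp: spans_ideal_def)
qed

lemma spans_ideal_A5: "spans_ideal (A5 a) x y \<longleftrightarrow> x = 0 \<and> y \<noteq> 0"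
  (is "?l \<longleftrightarrow> ?r")
proof
  assume l: ?l
  then have eqs: "x * ((1 - a) * x) = 0" "x * ((2 * a - 1) * x) = 0"
    unfolding spans_ideal_def
    by (metis msc_rows(9,10) add.right_neutral mult_zero_left mult_zero_right vector_4)+
  \<comment> \<open>The coefficients satisfy \<open>2 * (1 - a) + (2 * a - 1) = 1\<close>, so they
    cannot both vanish.\<close>
  then have "x * x = 0" by algebra
  with l show ?r by (auto simp: spans_ideal_def)
next
  assume ?r then show ?l by (auto simp: spans_ideal_def)
qed

text \<open>In \<open>A6\<close> and \<open>A7\<close> the commutator is \<open>e_2\<close> up to
  sign, so only the line of \<open>e_2\<close> could be an ideal; but \<open>e_2 e_2 = e_1\<close>
  in \<open>A6\<close> and \<open>e_2 e_1 = e_1\<close> in \<open>A7\<close>.\<close>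

lemma spans_ideal_A6: "\<not> spans_ideal (A6 a b) x y"
proof
  assume l: "spans_ideal (A6 a b) x y"
  then have eqs: "x * (x * (1 - a)) = y * y" "x * (x * - a) = y * y"
    by (simp_all add: spans_ideal_def algebra_simps)
  then have "x * x = 0" by algebra
  with eqs l show False by (auto simp: spans_ideal_def)
qed

lemma spans_ideal_A7: "\<not> spans_ideal (A7 b) x y"
proof
  assume l: "spans_ideal (A7 b) x y"
  then have eqs: "x * (b * x) = y * y" "x * (b * x + y) = y * y" "x * (- y) = y * x"
    "x * (x - y) = y * x"
    by (simp_all add: spans_ideal_def)
  then have "x * x = 0" by algebra
  with eqs l show False by (auto simp: spans_ideal_def)
qed

lemma spans_ideal_A8: "spans_ideal (A8 a) x y \<longleftrightarrow> x = 0 \<and> y \<noteq> 0"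
  by (auto simp: spans_ideal_def)

lemma spans_ideal_A9:
  assumes "(3::'a::field) \<noteq> 0"
  shows "spans_ideal (A9 :: 'a^4^2) x y \<longleftrightarrow> x = 0 \<and> y \<noteq> 0"
  using assms by (auto simp: spans_ideal_def)

lemma spans_ideal_A10: "spans_ideal A10 x y \<longleftrightarrow> x \<noteq> 0 \<and> y = 0"
  by (auto simp: spans_ideal_def)

lemma spans_ideal_A11:
  assumes "(2::'a::field) \<noteq> 0"
  shows "\<not> spans_ideal (A11 :: 'a^4^2) x y"
proof
  assume l: "spans_ideal (A11 :: 'a^4^2) x y"
  then have eqs: "x * x = y * y" "x * - y = y * x"
    by (simp_all add: spans_ideal_def)
  then have "2 * (x * y) = 0" by algebra
  with assms have "x = 0 \<or> y = 0" by simp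
  with eqs l show False by (auto simp: spans_ideal_def)
qed

lemma spans_ideal_A12: "spans_ideal A12 x y \<longleftrightarrow> x = 0 \<and> y \<noteq> 0"
  by (auto simp: spans_ideal_def)

section \<open>Isomorphisms\<close>

lemma isomorphic_algebras_sym:
  assumes "isomorphic_algebras s m s' m'"
  shows "isomorphic_algebras s' m' s m"
proof -
  from assms obtain f where f: "Vector_Spaces.linear s s' f" "bij f"
    and hom: "\<And>x y. f (m x y) = m' (f x) (f y)"
    unfolding isomorphic_algebras_def by blast
  interpret Vector_Spaces.linear s s' f by (rule f(1))
  have inv [simp]: "inv f (f x) = x" "f (inv f y) = y" for x y
    using f(2) by (simp_all add: bij_is_inj bij_is_surj surj_f_inv_f)
  have eqI: "x = y" if "f x = f y" for x y
    using f(2) that by (simp add: bij_is_inj inj_eq)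
  have "Vector_Spaces.linear s' s (inv f)"
    unfolding Vector_Spaces.linear_iff
    using vs1.vector_space_axioms vs2.vector_space_axioms
    by (auto intro!: eqI simp: add scale)
  moreover have "inv f (m' x y) = m (inv f x) (inv f y)" for x y
    by (rule eqI) (simp add: hom)
  ultimately show ?thesis
    using f(2) bij_imp_bij_inv unfolding isomorphic_algebras_def by blast
qed

lemma isomorphic_algebras_trans:
  assumes "isomorphic_algebras s m s' m'" "isomorphic_algebras s' m' s'' m''"
  shows "isomorphic_algebras s m s'' m''"
proof -
  from assms obtain f g
    where "Vector_Spaces.linear s s' f" "bij f" "\<And>x y. f (m x y) = m' (f x) (f y)"
      and "Vector_Spaces.linear s' s'' g" "bij g" "\<And>x y. g (m' x y) = m'' (g x) (g y)"
    unfolding isomorphic_algebras_def by blast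
  then show ?thesis
    unfolding isomorphic_algebras_def
    by (intro exI[of _ "g \<circ> f"]) (simp add: Vector_Spaces.linear_compose bij_comp)
qed

lemma isomorphic_algebras_ideals_empty:
  assumes "isomorphic_algebras s m s' m'" "nontrivial_ideals s' m' = {}"
  shows "nontrivial_ideals s m = {}"
proof (rule ccontr)
  assume "nontrivial_ideals s m \<noteq> {}"
  then obtain u where u: "u \<noteq> 0"
    "\<And>v. m v u \<in> module.span s {u}" "\<And>v. m u v \<in> module.span s {u}"
    unfolding nontrivial_ideals_def by blast
  from assms(1) obtain f where f: "Vector_Spaces.linear s s' f" "bij f"
    and hom: "\<And>x y. f (m x y) = m' (f x) (f y)"
    unfolding isomorphic_algebras_def by blast
  interpret Vector_Spaces.linear s s' f by (rule f(1))
  have span: "f x \<in> vs2.span {f u}" if "x \<in> vs1.span {u}" for x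
    using that by (auto simp: vs1.span_singleton vs2.span_singleton scale)
  have "m' (f v) (f u) \<in> vs2.span {f u}" "m' (f u) (f v) \<in> vs2.span {f u}" for v
    using span[OF u(2)] span[OF u(3)] by (simp_all add: hom)
  then have "m' w (f u) \<in> vs2.span {f u}" "m' (f u) w \<in> vs2.span {f u}" for w
    using f(2) by (metis bij_pointE)+
  moreover have "f u \<noteq> 0"
    using u(1) f(2) by (metis bij_is_inj injD zero)
  ultimately have "nontrivial_ideals s' m' \<noteq> {}"
    unfolding nontrivial_ideals_def by blast
  with assms(2) show False by simp
qed

section \<open>Coordinates, structure constants and changes of basis\<close>

lemma linear_vec2_expand:
  fixes f :: "'a::field^2 \<Rightarrow> 'v::ab_group_add"
  assumes "Vector_Spaces.linear (*s) s f"
  shows "f x = s (x $ 1) (f (vector [1, 0])) + s (x $ 2) (f (vector [0, 1]))"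
proof -
  interpret Vector_Spaces.linear "(*s)" s f by (rule assms)
  have "x = x $ 1 *s vector [1, 0] + x $ 2 *s vector [0, 1]"
    by (simp add: vec2_eq_iff)
  then have "f x = f (x $ 1 *s vector [1, 0] + x $ 2 *s vector [0, 1])" by simp
  then show ?thesis by (simp add: add scale)
qed

lemma two_dim_algebra_coordinates:
  fixes s :: "'a::field \<Rightarrow> 'v::ab_group_add \<Rightarrow> 'v"
  assumes "vector_space s" "vector_space.dim s UNIV = 2"
  obtains f :: "'a^2 \<Rightarrow> 'v" where "Vector_Spaces.linear (*s) s f" "bij f"
proof -
  interpret vector_space s by (rule assms(1))
  obtain B where B: "independent B" "UNIV \<subseteq> span B" "card B = 2"
    using basis_exists[of UNIV] assms(2) by metis
  then obtain b c where bc: "B = {b, c}" "b \<noteq> c"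
    by (metis card_2_iff)
  define f :: "'a^2 \<Rightarrow> 'v" where "f x = s (x $ 1) b + s (x $ 2) c" for x
  have lin: "Vector_Spaces.linear (*s) s f"
    unfolding Vector_Spaces.linear_iff f_def
    using vec.vector_space_axioms vector_space_axioms
    by (simp add: scale_left_distrib scale_right_distrib)
  interpret f: Vector_Spaces.linear "(*s)" s f by (rule lin)
  have "x = 0" if "f x = 0" for x
  proof -
    define w where "w v = (if v = b then x $ 1 else x $ 2)" for v
    have "(\<Sum>v\<in>B. s (w v) v) = 0"
      using that bc by (simp add: f_def w_def)
    then have "w v = 0" if "v \<in> B" for v
      using independentD[OF B(1), of B w v] that bc by simp
    from this[of b] this[of c] show ?thesis
      using bc by (simp add: w_def vec2_eq_iff)
  qed
  then have "inj f" by (simp add: f.inj_iff_eq_0)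
  moreover have "surj f"
  proof
    show "UNIV \<subseteq> range f"
    proof
      fix v :: 'v
      have "v \<in> span {b, c}" using B(2) bc by auto
      then obtain k l where "v = s k b + s l c"
        by (auto simp: span_insert span_singleton algebra_simps)
      then have "v = f (vector [k, l])" by (simp add: f_def)
      then show "v \<in> range f" by blast
    qed
  qed simp
  ultimately show ?thesis using that lin by (simp add: bij_def)
qed

text \<open>\<open>A\<close> holds the structure constants of \<open>m\<close> in the basis
  \<open>f e_1\<close>, \<open>f e_2\<close>. The equation for the given \<open>f\<close> is
  returned as well, since a mere isomorphism would forget this basis.\<close>

lemma ex_msc_isomorphic:
  fixes s :: "'a::field \<Rightarrow> 'v::ab_group_add \<Rightarrow> 'v"
  assumes "\<And>x. Vector_Spaces.linear s s (\<lambda>y. m x y)" "\<And>y. Vector_Spaces.linear s s (\<lambda>x. m x y)"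
    and f: "Vector_Spaces.linear (*s) s f" "bij f"
  obtains A :: "'a^4^2" where "isomorphic_algebras (*s) (msc_prod A) s m"
    "\<And>x y. f (msc_prod A x y) = m (f x) (f y)"
proof -
  interpret f: Vector_Spaces.linear "(*s)" s f by (rule f(1))
  interpret r: Vector_Spaces.linear s s "\<lambda>y. m x y" for x by (rule assms(1))
  interpret l: Vector_Spaces.linear s s "\<lambda>x. m x y" for y by (rule assms(2))
  let ?e = "vector [1, 0] :: 'a^2" and ?e' = "vector [0, 1] :: 'a^2"
  define c where "c u v = inv f (m (f u) (f v))" for u v
  have c: "f (c u v) = m (f u) (f v)" for u v
    using f(2) by (simp add: c_def bij_is_surj surj_f_inv_f)
  define A :: "'a^4^2"
    where "A = vector [vector [c ?e ?e $ 1, c ?e ?e' $ 1, c ?e' ?e $ 1, c ?e' ?e' $ 1],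
                       vector [c ?e ?e $ 2, c ?e ?e' $ 2, c ?e' ?e $ 2, c ?e' ?e' $ 2]]"
  have hom: "f (msc_prod A x y) = m (f x) (f y)" for x y
  proof -
    have "msc_prod A x y = (x $ 1 * y $ 1) *s c ?e ?e + (x $ 1 * y $ 2) *s c ?e ?e' +
        (x $ 2 * y $ 1) *s c ?e' ?e + (x $ 2 * y $ 2) *s c ?e' ?e'"
      by (simp add: msc_prod_def A_def vec2_eq_iff algebra_simps)
    then have "f (msc_prod A x y) =
        s (x $ 1 * y $ 1) (m (f ?e) (f ?e)) + s (x $ 1 * y $ 2) (m (f ?e) (f ?e')) +
        s (x $ 2 * y $ 1) (m (f ?e') (f ?e)) + s (x $ 2 * y $ 2) (m (f ?e') (f ?e'))"
      by (simp add: f.add f.scale c)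
    also have "\<dots> = m (s (x $ 1) (f ?e) + s (x $ 2) (f ?e')) (s (y $ 1) (f ?e) + s (y $ 2) (f ?e'))"
      by (simp add: l.add r.add l.scale r.scale f.vs2.scale_right_distrib algebra_simps)
    also have "\<dots> = m (f x) (f y)"
      by (metis linear_vec2_expand[OF f(1)])
    finally show ?thesis .
  qed
  show ?thesis
    using that[OF _ hom] f hom unfolding isomorphic_algebras_def by blast
qed

lemma msc_prod_linear:
  "Vector_Spaces.linear (*s) (*s) (\<lambda>y. msc_prod A x y)"
  "Vector_Spaces.linear (*s) (*s) (\<lambda>x. msc_prod A x y)"
  unfolding Vector_Spaces.linear_iff
  by (simp_all add: vec.vector_space_axioms msc_prod_def vec2_eq_iff algebra_simps)

lemma two_dim_algebra_msc: "two_dim_algebra (*s) (msc_prod (A :: 'a::field^4^2))"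
proof -
  have "vec.dim (UNIV :: ('a^2) set) = 2"
    by (subst vec_dim_card) simp
  then show ?thesis
    unfolding two_dim_algebra_def using vec.vector_space_axioms msc_prod_linear by blast
qed

text \<open>The linear map with matrix \<open>(p, q; r, s)\<close> is an isomorphism from the algebra of \<open>A\<close> onto that
  of \<open>B\<close>, written out on the products \<open>e\<^sub>i e\<^sub>j\<close>.\<close>

definition basis_change :: "'a::field \<Rightarrow> 'a \<Rightarrow> 'a \<Rightarrow> 'a \<Rightarrow> 'a^4^2 \<Rightarrow> 'a^4^2 \<Rightarrow> bool" where
  "basis_change p q r s A B \<longleftrightarrow> p * s - q * r \<noteq> 0 \<and>
     vector [p * A $ 1 $ 1 + q * A $ 2 $ 1, r * A $ 1 $ 1 + s * A $ 2 $ 1] =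
       msc_prod B (vector [p, r]) (vector [p, r]) \<and>
     vector [p * A $ 1 $ 2 + q * A $ 2 $ 2, r * A $ 1 $ 2 + s * A $ 2 $ 2] =
       msc_prod B (vector [p, r]) (vector [q, s]) \<and>
     vector [p * A $ 1 $ 3 + q * A $ 2 $ 3, r * A $ 1 $ 3 + s * A $ 2 $ 3] =
       msc_prod B (vector [q, s]) (vector [p, r]) \<and>
     vector [p * A $ 1 $ 4 + q * A $ 2 $ 4, r * A $ 1 $ 4 + s * A $ 2 $ 4] =
       msc_prod B (vector [q, s]) (vector [q, s])"

lemma basis_change_of_hom:
  fixes f :: "'a::field^2 \<Rightarrow> 'a^2"
  assumes f: "Vector_Spaces.linear (*s) (*s) f" "inj f"
    and hom: "\<And>x y. f (msc_prod A x y) = msc_prod B (f x) (f y)"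
  shows "basis_change (f (vector [1, 0]) $ 1) (f (vector [0, 1]) $ 1)
    (f (vector [1, 0]) $ 2) (f (vector [0, 1]) $ 2) A B"
proof -
  define p q r s where d: "p = f (vector [1, 0]) $ 1" "q = f (vector [0, 1]) $ 1"
    "r = f (vector [1, 0]) $ 2" "s = f (vector [0, 1]) $ 2"
  interpret f: Vector_Spaces.linear "(*s)" "(*s)" f by (rule f(1))
  have e: "f (vector [1, 0]) = vector [p, r]" "f (vector [0, 1]) = vector [q, s]"
    by (simp_all add: d vec2_eq_iff)
  have fx: "f x = vector [p * x $ 1 + q * x $ 2, r * x $ 1 + s * x $ 2]" for x
    by (subst linear_vec2_expand[OF f(1)]) (simp add: e vec2_eq_iff algebra_simps)
  have inj: "x = 0" if "f x = 0" for x
    using that f(2) by (metis f.zero injD)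
  have det: "p * s - q * r \<noteq> 0"
  proof
    assume "p * s - q * r = 0"
    \<comment> \<open>Up to sign these are the columns of the adjugate, which a singular matrix
      annihilates.\<close>
    then have "f (vector [q, - p]) = 0" "f (vector [s, - r]) = 0"
      by (simp_all add: fx vec2_eq_iff algebra_simps)
    then have "vector [q, - p] = (0 :: 'a^2)" "vector [s, - r] = (0 :: 'a^2)"
      using inj by blast+
    then have "p = 0" "r = 0" by (simp_all add: vec2_eq_iff)
    then have "f (vector [1, 0]) = 0" by (simp add: fx vec2_eq_iff)
    then have "vector [1, 0] = (0 :: 'a^2)" by (rule inj)
    then show False by (simp add: vec2_eq_iff)
  qed
  have cols: "msc_prod A (vector [1, 0]) (vector [1, 0]) = vector [A $ 1 $ 1, A $ 2 $ 1]"
    "msc_prod A (vector [1, 0]) (vector [0, 1]) = vector [A $ 1 $ 2, A $ 2 $ 2]"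
    "msc_prod A (vector [0, 1]) (vector [1, 0]) = vector [A $ 1 $ 3, A $ 2 $ 3]"
    "msc_prod A (vector [0, 1]) (vector [0, 1]) = vector [A $ 1 $ 4, A $ 2 $ 4]"
    by (simp_all add: msc_prod_def vec2_eq_iff)
  show ?thesis
    unfolding d[symmetric] basis_change_def
    using det hom[of "vector [1, 0]" "vector [1, 0]"] hom[of "vector [1, 0]" "vector [0, 1]"]
      hom[of "vector [0, 1]" "vector [1, 0]"] hom[of "vector [0, 1]" "vector [0, 1]"]
    unfolding cols e by (simp add: fx)
qed

lemma isomorphic_imp_basis_change:
  assumes "isomorphic_algebras (*s) (msc_prod A) (*s) (msc_prod B)"
  obtains p q r s where "basis_change p q r s A B"
  using assms basis_change_of_hom bij_is_inj unfolding isomorphic_algebras_def by metis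

text \<open>The vectors \<open>(p, r)\<close> and \<open>(q, s)\<close> form a new basis of the
  algebra of \<open>A\<close>, and \<open>B\<close> is its matrix in that basis. The map goes from
  new to old coordinates, hence the order \<open>B A\<close>.\<close>

lemma ex_basis_change:
  fixes A :: "'a::field^4^2"
  assumes det: "p * s - q * r \<noteq> 0"
  obtains B where "basis_change p q r s B A"
    "isomorphic_algebras (*s) (msc_prod B) (*s) (msc_prod A)"
proof -
  define f :: "'a^2 \<Rightarrow> 'a^2"
    where "f x = vector [p * x $ 1 + q * x $ 2, r * x $ 1 + s * x $ 2]" for x
  have lin: "Vector_Spaces.linear (*s) (*s) f"
    unfolding Vector_Spaces.linear_iff f_def
    by (simp add: vec.vector_space_axioms vec2_eq_iff algebra_simps)
  define g :: "'a^2 \<Rightarrow> 'a^2"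
    where "g y = vector [(s * y $ 1 - q * y $ 2) / (p * s - q * r),
                         (p * y $ 2 - r * y $ 1) / (p * s - q * r)]" for y
  have "g (f x) = x" for x
  proof -
    have "s * (p * x $ 1 + q * x $ 2) - q * (r * x $ 1 + s * x $ 2) = (p * s - q * r) * x $ 1"
      "p * (r * x $ 1 + s * x $ 2) - r * (p * x $ 1 + q * x $ 2) = (p * s - q * r) * x $ 2"
      by (simp_all add: algebra_simps)
    with det show ?thesis by (simp add: f_def g_def vec2_eq_iff)
  qed
  moreover have "f (g y) = y" for y
  proof -
    have "p * (s * y $ 1 - q * y $ 2) + q * (p * y $ 2 - r * y $ 1) = (p * s - q * r) * y $ 1"
      "r * (s * y $ 1 - q * y $ 2) + s * (p * y $ 2 - r * y $ 1) = (p * s - q * r) * y $ 2"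
      by (simp_all add: algebra_simps)
    with det show ?thesis
      by (simp add: f_def g_def vec2_eq_iff add_divide_distrib[symmetric])
  qed
  ultimately have bij: "bij f" by (metis bijI')
  obtain B where "isomorphic_algebras (*s) (msc_prod B) (*s) (msc_prod A)"
    and hom: "\<And>x y. f (msc_prod B x y) = msc_prod A (f x) (f y)"
    using ex_msc_isomorphic[OF msc_prod_linear lin bij] by blast
  moreover have "basis_change p q r s B A"
    using basis_change_of_hom[OF lin bij_is_inj[OF bij] hom] by (simp add: f_def)
  ultimately show ?thesis using that by blast
qed

lemma basis_change_iff:
  "basis_change p q r s A B \<longleftrightarrow> p * s - q * r \<noteq> 0 \<and>
     p * A $ 1 $ 1 + q * A $ 2 $ 1 =
       B $ 1 $ 1 * p * p + B $ 1 $ 2 * p * r + B $ 1 $ 3 * r * p + B $ 1 $ 4 * r * r \<and>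
     r * A $ 1 $ 1 + s * A $ 2 $ 1 =
       B $ 2 $ 1 * p * p + B $ 2 $ 2 * p * r + B $ 2 $ 3 * r * p + B $ 2 $ 4 * r * r \<and>
     p * A $ 1 $ 2 + q * A $ 2 $ 2 =
       B $ 1 $ 1 * p * q + B $ 1 $ 2 * p * s + B $ 1 $ 3 * r * q + B $ 1 $ 4 * r * s \<and>
     r * A $ 1 $ 2 + s * A $ 2 $ 2 =
       B $ 2 $ 1 * p * q + B $ 2 $ 2 * p * s + B $ 2 $ 3 * r * q + B $ 2 $ 4 * r * s \<and>
     p * A $ 1 $ 3 + q * A $ 2 $ 3 =
       B $ 1 $ 1 * q * p + B $ 1 $ 2 * q * r + B $ 1 $ 3 * s * p + B $ 1 $ 4 * s * r \<and>
     r * A $ 1 $ 3 + s * A $ 2 $ 3 =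
       B $ 2 $ 1 * q * p + B $ 2 $ 2 * q * r + B $ 2 $ 3 * s * p + B $ 2 $ 4 * s * r \<and>
     p * A $ 1 $ 4 + q * A $ 2 $ 4 =
       B $ 1 $ 1 * q * q + B $ 1 $ 2 * q * s + B $ 1 $ 3 * s * q + B $ 1 $ 4 * s * s \<and>
     r * A $ 1 $ 4 + s * A $ 2 $ 4 =
       B $ 2 $ 1 * q * q + B $ 2 $ 2 * q * s + B $ 2 $ 3 * s * q + B $ 2 $ 4 * s * s"
  by (simp add: basis_change_def msc_prod_def vec2_eq_iff conj_assoc)

section \<open>Trace forms\<close>

text \<open>The traces of right and of left multiplication by \<open>x e\<^sub>1 + y e\<^sub>2\<close>.\<close>

definition rtr :: "'a::field^4^2 \<Rightarrow> 'a \<Rightarrow> 'a \<Rightarrow> 'a" where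
  "rtr A x y = (A $ 1 $ 1 + A $ 2 $ 3) * x + (A $ 1 $ 2 + A $ 2 $ 4) * y"

definition ltr :: "'a::field^4^2 \<Rightarrow> 'a \<Rightarrow> 'a \<Rightarrow> 'a" where
  "ltr A x y = (A $ 1 $ 1 + A $ 2 $ 2) * x + (A $ 1 $ 3 + A $ 2 $ 4) * y"

text \<open>Conjugate operators have equal traces. Here this is a polynomial identity after
  multiplication by the determinant, which is then cancelled.\<close>

lemma trace_basis_change:
  assumes "basis_change p q r s A B"
  shows "rtr A 1 0 = rtr B p r" "rtr A 0 1 = rtr B q s"
    "ltr A 1 0 = ltr B p r" "ltr A 0 1 = ltr B q s"
proof -
  from assms have det: "p * s - q * r \<noteq> 0"
    and e11: "p * A $ 1 $ 1 + q * A $ 2 $ 1 =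
       B $ 1 $ 1 * p * p + B $ 1 $ 2 * p * r + B $ 1 $ 3 * r * p + B $ 1 $ 4 * r * r"
      "r * A $ 1 $ 1 + s * A $ 2 $ 1 =
       B $ 2 $ 1 * p * p + B $ 2 $ 2 * p * r + B $ 2 $ 3 * r * p + B $ 2 $ 4 * r * r"
    and e12: "p * A $ 1 $ 2 + q * A $ 2 $ 2 =
       B $ 1 $ 1 * p * q + B $ 1 $ 2 * p * s + B $ 1 $ 3 * r * q + B $ 1 $ 4 * r * s"
      "r * A $ 1 $ 2 + s * A $ 2 $ 2 =
       B $ 2 $ 1 * p * q + B $ 2 $ 2 * p * s + B $ 2 $ 3 * r * q + B $ 2 $ 4 * r * s"
    and e21: "p * A $ 1 $ 3 + q * A $ 2 $ 3 =
       B $ 1 $ 1 * q * p + B $ 1 $ 2 * q * r + B $ 1 $ 3 * s * p + B $ 1 $ 4 * s * r"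
      "r * A $ 1 $ 3 + s * A $ 2 $ 3 =
       B $ 2 $ 1 * q * p + B $ 2 $ 2 * q * r + B $ 2 $ 3 * s * p + B $ 2 $ 4 * s * r"
    and e22: "p * A $ 1 $ 4 + q * A $ 2 $ 4 =
       B $ 1 $ 1 * q * q + B $ 1 $ 2 * q * s + B $ 1 $ 3 * s * q + B $ 1 $ 4 * s * s"
      "r * A $ 1 $ 4 + s * A $ 2 $ 4 =
       B $ 2 $ 1 * q * q + B $ 2 $ 2 * q * s + B $ 2 $ 3 * s * q + B $ 2 $ 4 * s * s"
    unfolding basis_change_iff by blast+
  have "(p * s - q * r) * rtr A 1 0 = (p * s - q * r) * rtr B p r"
    using e11 e21 unfolding rtr_def by algebra
  with det show "rtr A 1 0 = rtr B p r" by simp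
  have "(p * s - q * r) * rtr A 0 1 = (p * s - q * r) * rtr B q s"
    using e12 e22 unfolding rtr_def by algebra
  with det show "rtr A 0 1 = rtr B q s" by simp
  have "(p * s - q * r) * ltr A 1 0 = (p * s - q * r) * ltr B p r"
    using e11 e12 unfolding ltr_def by algebra
  with det show "ltr A 1 0 = ltr B p r" by simp
  have "(p * s - q * r) * ltr A 0 1 = (p * s - q * r) * ltr B q s"
    using e21 e22 unfolding ltr_def by algebra
  with det show "ltr A 0 1 = ltr B q s" by simp
qed

section \<open>Normal forms\<close>

lemma normal_form_square:
  fixes A :: "'a::field^4^2"
  assumes tr: "rtr A 0 1 = 0" "ltr A 0 1 = 0" and c: "c * c * A $ 1 $ 4 = 1"
  obtains B a b where "isomorphic_algebras (*s) (msc_prod B) (*s) (msc_prod A)"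
    "B $ 1 = vector [a, 0, 0, 1]" "B $ 2 = vector [b, ltr A 1 0 - a, rtr A 1 0 - a, 0]"
proof -
  \<comment> \<open>The new basis is \<open>(e\<^sub>2 e\<^sub>2, e\<^sub>2)\<close> with \<open>e\<^sub>2\<close> replaced by \<open>c e\<^sub>2\<close>.\<close>
  define t where "t = c * c * A $ 2 $ 4"
  have c0: "c \<noteq> 0" using c by auto
  obtain B where iso: "isomorphic_algebras (*s) (msc_prod B) (*s) (msc_prod A)"
    and bc: "basis_change 1 0 t c B A"
    using ex_basis_change[of 1 c 0 t A] c0 by auto
  have B14: "B $ 1 $ 4 = 1"
    using bc c unfolding basis_change_iff by (simp add: mult.assoc mult.left_commute mult.commute)
  have "t * B $ 1 $ 4 + c * B $ 2 $ 4 =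
      A $ 2 $ 1 * 0 * 0 + A $ 2 $ 2 * 0 * c + A $ 2 $ 3 * c * 0 + A $ 2 $ 4 * c * c"
    using bc unfolding basis_change_iff by blast
  then have "t * B $ 1 $ 4 + c * B $ 2 $ 4 = t"
    by (simp add: t_def mult.assoc mult.commute)
  with B14 c0 have B24: "B $ 2 $ 4 = 0" by simp
  have trB: "rtr B 1 0 = rtr A 1 0" "ltr B 1 0 = ltr A 1 0" "rtr B 0 1 = 0" "ltr B 0 1 = 0"
    using trace_basis_change[OF bc] tr by (simp_all add: rtr_def ltr_def)
  \<comment> \<open>Since \<open>B $ 2 $ 4 = 0\<close>, the traces of \<open>e_2\<close> are just
    these two entries, and the traces of \<open>e_1\<close> then determine two entries of the second
    row.\<close>
  have "B $ 1 $ 2 = 0" "B $ 1 $ 3 = 0"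
    "B $ 2 $ 2 = ltr A 1 0 - B $ 1 $ 1" "B $ 2 $ 3 = rtr A 1 0 - B $ 1 $ 1"
    using trB(3,4) B24 unfolding trB(1,2)[symmetric] by (simp_all add: rtr_def ltr_def)
  then show ?thesis
    using that[OF iso, of "B $ 1 $ 1" "B $ 2 $ 1"] B14 B24 by (simp add: vec_eq_iff forall_4)
qed

lemma normal_form_invariant_line:
  fixes A :: "'a::field^4^2"
  assumes tr: "rtr A 0 1 = 0" "ltr A 0 1 = 0" and A: "A $ 1 $ 4 = 0" "A $ 2 $ 4 \<noteq> 0"
    and two: "(2::'a) \<noteq> 0"
  obtains B b where "isomorphic_algebras (*s) (msc_prod B) (*s) (msc_prod A)"
    "B $ 1 = vector [0, 1, 1, 0]" "B $ 2 = vector [b, ltr A 1 0, rtr A 1 0, - 1]"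
proof -
  \<comment> \<open>\<open>c\<close> normalises \<open>e\<^sub>2 e\<^sub>2\<close>, and \<open>t\<close> then removes the \<open>e\<^sub>1\<close>-coordinate of \<open>e\<^sub>1 e\<^sub>1\<close>.\<close>
  define c where "c = - 1 / A $ 2 $ 4"
  define t where "t = A $ 1 $ 1 / (2 * A $ 2 $ 4)"
  have c0: "c \<noteq> 0" and c: "c * A $ 2 $ 4 = - 1" and t: "2 * (t * A $ 2 $ 4) = A $ 1 $ 1"
    using A two by (simp_all add: c_def t_def)
  obtain B where iso: "isomorphic_algebras (*s) (msc_prod B) (*s) (msc_prod A)"
    and bc: "basis_change 1 0 t c B A"
    using ex_basis_change[of 1 c 0 t A] c0 by auto
  have B14: "B $ 1 $ 4 = 0"
    using bc A unfolding basis_change_iff by simp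
  have "c * B $ 2 $ 4 = A $ 2 $ 4 * c * c"
    using bc B14 c0 unfolding basis_change_iff by simp
  then have "c * B $ 2 $ 4 = c * (- 1)"
    using c by (simp add: mult.assoc mult.commute)
  with c0 have B24: "B $ 2 $ 4 = - 1"
    using mult_left_cancel by blast
  \<comment> \<open>The vanishing traces of \<open>e_2\<close> make both mixed terms of
    \<open>(e_1 + t e_2)^2\<close> contribute \<open>- t * A $ 2 $ 4\<close> to its
    \<open>e_1\<close>-coordinate; this is the origin of the 2 in the denominator of
    \<open>t\<close>.\<close>
  have A12: "A $ 1 $ 2 = - A $ 2 $ 4" "A $ 1 $ 3 = - A $ 2 $ 4"
    using tr by (simp_all add: rtr_def ltr_def eq_neg_iff_add_eq_0)
  have "B $ 1 $ 1 = A $ 1 $ 1 + A $ 1 $ 2 * t + A $ 1 $ 3 * t"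
    using bc A unfolding basis_change_iff by simp
  also have "\<dots> = A $ 1 $ 1 - 2 * (t * A $ 2 $ 4)"
    by (simp add: A12 algebra_simps)
  finally have B11: "B $ 1 $ 1 = 0" by (simp add: t)
  have trB: "rtr B 1 0 = rtr A 1 0" "ltr B 1 0 = ltr A 1 0" "rtr B 0 1 = 0" "ltr B 0 1 = 0"
    using trace_basis_change[OF bc] tr by (simp_all add: rtr_def ltr_def)
  have "B $ 1 $ 2 = 1" "B $ 1 $ 3 = 1" "B $ 2 $ 2 = ltr A 1 0" "B $ 2 $ 3 = rtr A 1 0"
    using trB(3,4) B24 B11 unfolding trB(1,2)[symmetric] by (simp_all add: rtr_def ltr_def)
  then show ?thesis
    using that[OF iso, of "B $ 2 $ 1"] B11 B14 B24 by (simp add: vec_eq_iff forall_4)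
qed

text \<open>With \<open>e_2 e_2 = 0\<close> the traces of \<open>e_2\<close> are the
  \<open>e_1\<close>-coordinates of \<open>e_1 e_2\<close> and \<open>e_2 e_1\<close>, so both
  products stay in the line of \<open>e_2\<close>.\<close>

lemma spans_ideal_null_line:
  assumes "rtr A 0 1 = 0" "ltr A 0 1 = 0" "A $ 1 $ 4 = 0" "A $ 2 $ 4 = 0"
  shows "spans_ideal A 0 1"
  using assms by (simp add: spans_ideal_def rtr_def ltr_def)

section \<open>From ideal-free normal forms to the list\<close>

lemma ideal_free_A1:
  assumes "\<And>x y. \<not> spans_ideal (A1 a b c d) x y"
  shows "ideal_free (A1 a b c d)"
  using assms[of 1 1] by (intro ideal_free.intros(1)) (auto simp: spans_ideal_A1)

lemma ideal_free_A2:
  fixes a b c :: "'a::field"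
  assumes two: "(2::'a) \<noteq> 0" and sqrt: "\<And>k :: 'a. \<exists>c. c * c = k"
    and none: "\<And>x y. \<not> spans_ideal (A2 a b c) x y"
  shows "ideal_free (A2 a b c)"
proof (cases "c = 1 - a")
  case False
  then show ?thesis by (rule ideal_free.intros(5))
next
  case c: True
  have half: "a = 1 / 2 \<longleftrightarrow> 2 * a - 1 = 0"
    using two by (auto simp: field_simps)
  consider "a = 1" | "a = 1 / 2" "a \<noteq> 1" | "a \<noteq> 1 / 2" "a \<noteq> 1" by blast
  then show ?thesis
  proof cases
    case 1
    then have "b \<noteq> 0" using none[of 1 0] c by (auto simp: spans_ideal_A2)
    with 1 c show ?thesis by (intro ideal_free.intros(2)) simp_all
  next
    case 2
    \<comment> \<open>At \<open>a = 1 / 2\<close> the linear condition on the slope reduces to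
      \<open>b = 0\<close>, so any square root of \<open>1 - a\<close> would be the slope of an
      ideal if \<open>b\<close> were zero.\<close>
    obtain y where "y * y = 1 - a" using sqrt by blast
    then have "b \<noteq> 0" using none[of 1 y] c 2 two by (auto simp: spans_ideal_A2 power2_eq_square)
    moreover have "c = 1 / 2" unfolding c 2(1) using two by (simp add: field_simps)
    ultimately show ?thesis using 2(1) by (intro ideal_free.intros(4)) blast+
  next
    case 3
    then have nz: "2 * a - 1 \<noteq> 0" using half by simp
    \<comment> \<open>The linear condition leaves only this slope; the quadratic one must therefore
      fail for it.\<close>
    have "\<not> spans_ideal (A2 a b c) 1 (b / (2 * a - 1))" by (rule none)
    with nz c have "b\<^sup>2 \<noteq> (1 - a) * (2 * a - 1)\<^sup>2"
      by (auto simp: spans_ideal_A2 power_divide divide_eq_eq)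
    then have "b\<^sup>2 + (a - 1) * (2 * a - 1)\<^sup>2 \<noteq> 0" by algebra
    with 3 c show ?thesis by (intro ideal_free.intros(3)) simp_all
  qed
qed

lemma ideal_free_A3:
  fixes b c :: "'a::field"
  assumes two: "(2::'a) \<noteq> 0" and none: "\<And>x y. \<not> spans_ideal (A3 b c) x y"
  shows "ideal_free (A3 b c)"
  using none[of 2 1] by (intro ideal_free.intros(6)) (auto simp: spans_ideal_A3[OF two])

lemma classification_dependent_traces:
  fixes A :: "'a::field^4^2"
  assumes two: "(2::'a) \<noteq> 0" and sqrt: "\<And>k :: 'a. \<exists>c. c * c = k"
    and tr: "rtr A 0 1 = 0" "ltr A 0 1 = 0"
    and cases: "rtr A 1 0 = 1 \<or> rtr A 1 0 = 0 \<and> ltr A 1 0 = 1"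
    and none: "msc_ideals A = {}"
  shows "\<exists>B. ideal_free B \<and> isomorphic_algebras (*s) (msc_prod B) (*s) (msc_prod A)"
proof (cases "A $ 1 $ 4 = 0")
  case False
  \<comment> \<open>Scaling \<open>e_2\<close> by \<open>c\<close> multiplies the
    \<open>e_1\<close>-coordinate of its square by \<open>c * c\<close>.\<close>
  obtain c where "c * c = 1 / A $ 1 $ 4" using sqrt by blast
  with False have "c * c * A $ 1 $ 4 = 1" by simp
  from normal_form_square[OF tr this]
  obtain B a b where iso: "isomorphic_algebras (*s) (msc_prod B) (*s) (msc_prod A)"
    and B: "B $ 1 = vector [a, 0, 0, 1]"
      "B $ 2 = vector [b, ltr A 1 0 - a, rtr A 1 0 - a, 0]"
    by blast
  from isomorphic_algebras_ideals_empty[OF iso none]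
  have noneB: "\<not> spans_ideal B x y" for x y
    by (simp add: msc_ideals_empty_iff)
  from cases have "ideal_free B"
  proof
    assume r: "rtr A 1 0 = 1"
    have "B = A2 a b (ltr A 1 0 - a)"
      using B r by (simp add: vec2_eq_iff)
    then show ?thesis using ideal_free_A2[OF two sqrt] noneB by metis
  next
    assume r: "rtr A 1 0 = 0 \<and> ltr A 1 0 = 1"
    have "B = A6 a b"
      using B r by (simp add: vec2_eq_iff)
    then show ?thesis using ideal_free.intros(7) by metis
  qed
  with iso show ?thesis by blast
next
  case True
  with spans_ideal_null_line[OF tr] none have "A $ 2 $ 4 \<noteq> 0"
    by (auto simp: msc_ideals_empty_iff)
  from normal_form_invariant_line[OF tr True this two]
  obtain B b where iso: "isomorphic_algebras (*s) (msc_prod B) (*s) (msc_prod A)"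
    and B: "B $ 1 = vector [0, 1, 1, 0]" "B $ 2 = vector [b, ltr A 1 0, rtr A 1 0, - 1]"
    by blast
  from isomorphic_algebras_ideals_empty[OF iso none]
  have noneB: "\<not> spans_ideal B x y" for x y
    by (simp add: msc_ideals_empty_iff)
  from cases have "ideal_free B"
  proof
    assume r: "rtr A 1 0 = 1"
    have "B = A3 b (ltr A 1 0)"
      using B r by (simp add: vec2_eq_iff)
    then show ?thesis using ideal_free_A3[OF two] noneB by metis
  next
    assume r: "rtr A 1 0 = 0 \<and> ltr A 1 0 = 1"
    have "B = A7 b"
      using B r by (simp add: vec2_eq_iff)
    then show ?thesis using ideal_free.intros(8) by metis
  qed
  with iso show ?thesis by blast
qed

text \<open>The sought line is a root of a binary cubic form. If \<open>A $ 1 $ 4 = 0\<close>, the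
  root at infinity, \<open>e_2\<close> itself, serves; otherwise the cubic in the slope has a
  nonzero leading coefficient.\<close>

lemma zero_trace_square_line:
  fixes A :: "'a::field^4^2"
  assumes cubic: "\<And>a b c d :: 'a. a \<noteq> 0 \<Longrightarrow> \<exists>t. a * t ^ 3 + b * t ^ 2 + c * t + d = 0"
    and tr: "rtr A 1 0 = 0" "rtr A 0 1 = 0" "ltr A 1 0 = 0" "ltr A 0 1 = 0"
  obtains B where "isomorphic_algebras (*s) (msc_prod B) (*s) (msc_prod A)" "B $ 1 $ 4 = 0"
proof (cases "A $ 1 $ 4 = 0")
  case True
  obtain B where iso: "isomorphic_algebras (*s) (msc_prod B) (*s) (msc_prod A)"
    and "basis_change 1 0 0 1 B A"
    using ex_basis_change[of 1 1 0 0 A] by auto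
  with True have "B $ 1 $ 4 = 0" by (simp add: basis_change_iff)
  with iso show ?thesis using that by blast
next
  case False
  \<comment> \<open>The cubic says that the square of \<open>e\<^sub>1 + t e\<^sub>2\<close> is a multiple of \<open>e\<^sub>1 + t e\<^sub>2\<close>.\<close>
  obtain t where t: "A $ 1 $ 4 * t ^ 3 + (A $ 1 $ 2 + A $ 1 $ 3 - A $ 2 $ 4) * t ^ 2 +
      (A $ 1 $ 1 - A $ 2 $ 2 - A $ 2 $ 3) * t + (- A $ 2 $ 1) = 0"
    using cubic[OF False] by blast
  \<comment> \<open>The vector \<open>e_1 + t e_2\<close> becomes the second basis vector and the
    old \<open>e_2\<close> the first.\<close>
  obtain B where iso: "isomorphic_algebras (*s) (msc_prod B) (*s) (msc_prod A)"
    and bc: "basis_change 0 1 1 t B A"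
    using ex_basis_change[of 0 t 1 1 A] by auto
  from bc have "0 * B $ 1 $ 4 + 1 * B $ 2 $ 4 =
      A $ 1 $ 1 * 1 * 1 + A $ 1 $ 2 * 1 * t + A $ 1 $ 3 * t * 1 + A $ 1 $ 4 * t * t"
    "1 * B $ 1 $ 4 + t * B $ 2 $ 4 =
      A $ 2 $ 1 * 1 * 1 + A $ 2 $ 2 * 1 * t + A $ 2 $ 3 * t * 1 + A $ 2 $ 4 * t * t"
    unfolding basis_change_iff by blast+
  with t have "B $ 1 $ 4 = 0" by algebra
  with iso show ?thesis using that by blast
qed

lemma classification_zero_traces:
  fixes A :: "'a::field^4^2"
  assumes two: "(2::'a) \<noteq> 0" and sqrt: "\<And>k :: 'a. \<exists>c. c * c = k"
    and cubic: "\<And>a b c d :: 'a. a \<noteq> 0 \<Longrightarrow> \<exists>t. a * t ^ 3 + b * t ^ 2 + c * t + d = 0"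
    and tr: "rtr A 1 0 = 0" "rtr A 0 1 = 0" "ltr A 1 0 = 0" "ltr A 0 1 = 0"
    and none: "msc_ideals A = {}"
  shows "\<exists>B. ideal_free B \<and> isomorphic_algebras (*s) (msc_prod B) (*s) (msc_prod A)"
proof -
  obtain B where iso: "isomorphic_algebras (*s) (msc_prod B) (*s) (msc_prod A)"
    and B14: "B $ 1 $ 4 = 0"
    using zero_trace_square_line[OF cubic tr] by blast
  obtain p q r s where "basis_change p q r s B A"
    using isomorphic_imp_basis_change[OF iso] .
  from trace_basis_change[OF this] tr
  have trB: "rtr B 1 0 = 0" "rtr B 0 1 = 0" "ltr B 1 0 = 0" "ltr B 0 1 = 0"
    by (simp_all add: rtr_def ltr_def)
  have noneB: "msc_ideals B = {}"
    using isomorphic_algebras_ideals_empty[OF iso none] .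
  with spans_ideal_null_line[OF trB(2,4) B14] have "B $ 2 $ 4 \<noteq> 0"
    by (auto simp: msc_ideals_empty_iff)
  from normal_form_invariant_line[OF trB(2,4) B14 this two]
  obtain C b where iso': "isomorphic_algebras (*s) (msc_prod C) (*s) (msc_prod B)"
    and C: "C $ 1 = vector [0, 1, 1, 0]" "C $ 2 = vector [b, 0, 0, - 1]"
    unfolding trB by blast
  have C': "C $ 1 $ 1 = 0" "C $ 1 $ 2 = 1" "C $ 1 $ 3 = 1" "C $ 1 $ 4 = 0"
    "C $ 2 $ 2 = 0" "C $ 2 $ 3 = 0" "C $ 2 $ 4 = - 1"
    by (simp_all add: C)
  \<comment> \<open>If \<open>C $ 2 $ 1\<close> were zero, \<open>C\<close> would be
    \<open>A10\<close>, where \<open>e_1\<close> spans an ideal.\<close>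
  have "\<not> spans_ideal C 1 0"
    using isomorphic_algebras_ideals_empty[OF iso' noneB] by (simp add: msc_ideals_empty_iff)
  then have C21: "C $ 2 $ 1 \<noteq> 0"
    using C' by (auto simp: spans_ideal_def)
  \<comment> \<open>Scaling \<open>e_1\<close> by \<open>k\<close> turns \<open>e_1 e_1\<close> into
    \<open>e_2\<close> and preserves the other entries.\<close>
  obtain k where "k * k = 1 / C $ 2 $ 1" using sqrt by blast
  with C21 have k: "C $ 2 $ 1 * k * k = 1" by (simp add: mult.assoc)
  then have k0: "k \<noteq> 0" by auto
  obtain D where iso'': "isomorphic_algebras (*s) (msc_prod D) (*s) (msc_prod C)"
    and bc: "basis_change k 0 0 1 D C"
    using ex_basis_change[of k 1 0 0 C] k0 by auto
  have "D = A11"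
    using bc k0 k by (simp add: basis_change_iff C' vec2_eq_iff) (simp add: vec_eq_iff forall_4)
  then show ?thesis
    using iso'' iso' iso isomorphic_algebras_trans ideal_free.intros(9) by metis
qed

lemma classification:
  fixes A :: "'a::field^4^2"
  assumes two: "(2::'a) \<noteq> 0" and sqrt: "\<And>k :: 'a. \<exists>c. c * c = k"
    and cubic: "\<And>a b c d :: 'a. a \<noteq> 0 \<Longrightarrow> \<exists>t. a * t ^ 3 + b * t ^ 2 + c * t + d = 0"
    and none: "msc_ideals A = {}"
  shows "\<exists>B. ideal_free B \<and> isomorphic_algebras (*s) (msc_prod B) (*s) (msc_prod A)"
proof -
  define r1 r2 l1 l2 where d: "r1 = rtr A 1 0" "r2 = rtr A 0 1" "l1 = ltr A 1 0" "l2 = ltr A 0 1"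
  have rtr: "rtr A x y = r1 * x + r2 * y" and ltr: "ltr A x y = l1 * x + l2 * y" for x y
    by (simp_all add: d rtr_def ltr_def)
  \<comment> \<open>The dependent case in one form: \<open>(q, s)\<close> lies in the common kernel
    of the traces, and \<open>(p, r)\<close> normalises the right trace, or the left one if the
    right one is zero there.\<close>
  have reduce: ?thesis
    if det: "p * s - q * r \<noteq> 0" and *: "r1 * q + r2 * s = 0" "l1 * q + l2 * s = 0"
      "r1 * p + r2 * r = 1 \<or> r1 * p + r2 * r = 0 \<and> l1 * p + l2 * r = 1" for p q r s
  proof -
    obtain B where iso: "isomorphic_algebras (*s) (msc_prod B) (*s) (msc_prod A)"
      and bc: "basis_change p q r s B A"
      using ex_basis_change[OF det] by blast
    have "\<exists>C. ideal_free C \<and> isomorphic_algebras (*s) (msc_prod C) (*s) (msc_prod B)"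
      by (rule classification_dependent_traces[OF two sqrt])
        (use * trace_basis_change[OF bc] isomorphic_algebras_ideals_empty[OF iso none]
          in \<open>simp_all add: rtr ltr\<close>)
    with iso show ?thesis using isomorphic_algebras_trans by blast
  qed
  show ?thesis
  proof (cases "r1 * l2 = r2 * l1")
    case False
    \<comment> \<open>\<open>D\<close> is the determinant of the two trace forms; the columns of the
      inverse of their matrix are the dual basis.\<close>
    define D where "D = r1 * l2 - r2 * l1"
    have D: "D \<noteq> 0" using False by (simp add: D_def)
    have "l2 / D * (r1 / D) - - r2 / D * (- l1 / D) = (r1 * l2 - r2 * l1) / (D * D)"
      by (simp add: diff_divide_distrib mult.commute)
    also have "\<dots> \<noteq> 0" using D by (simp add: D_def)
    finally have det: "l2 / D * (r1 / D) - - r2 / D * (- l1 / D) \<noteq> 0" .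
    obtain B where iso: "isomorphic_algebras (*s) (msc_prod B) (*s) (msc_prod A)"
      and bc: "basis_change (l2 / D) (- r2 / D) (- l1 / D) (r1 / D) B A"
      using ex_basis_change[OF det] by blast
    have inv: "r1 * (l2 / D) + r2 * (- l1 / D) = 1" "r1 * (- r2 / D) + r2 * (r1 / D) = 0"
      "l1 * (l2 / D) + l2 * (- l1 / D) = 0" "l1 * (- r2 / D) + l2 * (r1 / D) = 1"
      using D by (simp_all add: field_simps) (simp_all add: D_def algebra_simps)
    have trB: "rtr B 1 0 = 1" "rtr B 0 1 = 0" "ltr B 1 0 = 0" "ltr B 0 1 = 1"
      using trace_basis_change[OF bc] inv by (simp_all add: rtr ltr)
    \<comment> \<open>The four trace equations express the other four entries exactly as in the
      shape of \<open>A1\<close>.\<close>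
    then have "B = A1 (B $ 1 $ 1) (B $ 1 $ 2) (B $ 1 $ 4) (B $ 2 $ 1)"
      by (simp add: rtr_def ltr_def vec2_eq_iff vec_eq_iff forall_4) algebra
    moreover have "\<not> spans_ideal B x y" for x y
      using isomorphic_algebras_ideals_empty[OF iso none] by (simp add: msc_ideals_empty_iff)
    ultimately have "ideal_free B" using ideal_free_A1 by metis
    with iso show ?thesis by blast
  next
    case True
    consider "r1 \<noteq> 0" | "r1 = 0" "r2 \<noteq> 0" | "r1 = 0" "r2 = 0" "l1 \<noteq> 0"
      | "r1 = 0" "r2 = 0" "l1 = 0" "l2 \<noteq> 0" | "r1 = 0" "r2 = 0" "l1 = 0" "l2 = 0"
      by blast
    then show ?thesis
    proof cases
      case 1
      \<comment> \<open>Here \<open>p = 1 / r1\<close>, \<open>s = r1\<close>,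
        \<open>q = - r2\<close>, \<open>r = 0\<close>: the vector \<open>(- r2, r1)\<close> spans
        the kernel of the right trace, and by dependence the left trace vanishes on it too.\<close>
      show ?thesis
        by (rule reduce[of "1 / r1" r1 "- r2" 0])
          (use 1 True in \<open>simp_all add: mult.commute\<close>)
    next
      case 2
      then have "l1 = 0" using True by simp
      show ?thesis
        by (rule reduce[of 0 0 1 "1 / r2"]) (use 2 \<open>l1 = 0\<close> in simp_all)
    next
      case 3
      show ?thesis
        by (rule reduce[of "1 / l1" l1 "- l2" 0]) (use 3 in \<open>simp_all add: mult.commute\<close>)
    next
      case 4
      show ?thesis
        by (rule reduce[of 0 0 1 "1 / l2"]) (use 4 in simp_all)
    next
      case 5
      then show ?thesis
        using classification_zero_traces[OF two sqrt cubic, of A] none by (simp add: d)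
    qed
  qed
qed

section \<open>Uniqueness of the normal forms\<close>

lemma ideal_free_shapes:
  assumes "ideal_free A"
  obtains (A1) a b c d where "A = A1 a b c d" | (A2) a b c where "A = A2 a b c"
    | (A3) b c where "A = A3 b c" | (A6) a b where "A = A6 a b" | (A7) b where "A = A7 b"
    | (A11) "A = A11"
  using assms by cases

text \<open>Preserving \<open>e_2 e_2 = e_1\<close> forces \<open>s * s = 1\<close> and
  \<open>r = 0\<close>; the choice \<open>s = - 1\<close> reverses the sign of
  \<open>b\<close>.\<close>

lemma square_normal_forms_basis_change:
  fixes A B :: "'a::field^4^2"
  assumes bc: "basis_change 1 0 r s A B"
    and A: "A $ 1 = vector [a, 0, 0, 1]" "A $ 2 = vector [b, c, d, 0]"
    and B: "B $ 1 = vector [a', 0, 0, 1]" "B $ 2 = vector [b', c', d', 0]"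
  shows "a' = a \<and> c' = c \<and> d' = d \<and> (b' = b \<or> b' = - b)"
proof -
  have s: "s * s = 1" and r: "r = 0"
    using bc unfolding basis_change_iff A B by simp_all
  from s have "s \<noteq> 0" by auto
  from s have "(s - 1) * (s + 1) = 0" by algebra
  then have "s = 1 \<or> s = - 1" by (auto simp: eq_neg_iff_add_eq_0)
  then show ?thesis
    using bc r \<open>s \<noteq> 0\<close> unfolding basis_change_iff A B by auto
qed

text \<open>The equation \<open>e_2 e_2 = - e_2\<close> fixes the scale \<open>s = 1\<close>, and
  the zero \<open>e_1\<close>-coordinate of \<open>e_1 e_1\<close> gives \<open>2 * r = 0\<close>.
  No freedom is left.\<close>

lemma invariant_line_normal_forms_basis_change:
  fixes A B :: "'a::field^4^2"
  assumes bc: "basis_change 1 0 r s A B" and two: "(2::'a) \<noteq> 0"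
    and A: "A $ 1 = vector [0, 1, 1, 0]" "A $ 2 = vector [b, c, d, - 1]"
    and B: "B $ 1 = vector [0, 1, 1, 0]" "B $ 2 = vector [b', c', d', - 1]"
  shows "A = B"
proof -
  have "s = 1" and "r + r = 0"
    using bc unfolding basis_change_iff A B by auto
  then have "2 * r = 0" by (simp only: mult_2)
  with two have "r = 0" by simp
  with bc \<open>s = 1\<close> have "b' = b" "c' = c" "d' = d"
    unfolding basis_change_iff A B by simp_all
  then show ?thesis using A B by (simp add: vec2_eq_iff)
qed

text \<open>A change with \<open>p = 1\<close>, \<open>q = 0\<close> preserves the line of
  \<open>e_2\<close>, and whether \<open>e_2 e_2\<close> lies in it does not depend on the
  basis.\<close>

lemma not_basis_change_square_invariant_line:
  assumes bc: "basis_change 1 0 r s A B"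
    and "A $ 1 = vector [a, 0, 0, 1]" "B $ 1 = vector [0, 1, 1, 0]"
  shows False
  using bc unfolding basis_change_iff assms(2,3) by auto

lemma not_basis_change_invariant_line_square:
  assumes bc: "basis_change 1 0 r s A B"
    and "A $ 1 = vector [0, 1, 1, 0]" "B $ 1 = vector [a, 0, 0, 1]"
  shows False
  using bc unfolding basis_change_iff assms(2,3) by auto

text \<open>These invariants separate \<open>A1\<close>, the pair \<open>A2\<close>,
  \<open>A3\<close>, the pair \<open>A6\<close>, \<open>A7\<close>, and \<open>A11\<close>; within a
  pair they force \<open>p = 1\<close> and \<open>q = 0\<close>.\<close>

lemma traces_normal_forms [simp]:
  "rtr (A1 a b c d) x y = x" "ltr (A1 a b c d) x y = y"
  "rtr (A2 a b e) x y = x" "ltr (A2 a b e) x y = (a + e) * x"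
  "rtr (A3 b e) x y = x" "ltr (A3 b e) x y = e * x"
  "rtr (A6 a b) x y = 0" "ltr (A6 a b) x y = x"
  "rtr (A7 b) x y = 0" "ltr (A7 b) x y = x"
  "rtr A11 x y = 0" "ltr A11 x y = 0"
  by (simp_all add: rtr_def ltr_def)

lemma isomorphic_imp_same:
  fixes A B :: "'a::field^4^2"
  assumes two: "(2::'a) \<noteq> 0" and A: "ideal_free A" and B: "ideal_free B"
    and iso: "isomorphic_algebras (*s) (msc_prod A) (*s) (msc_prod B)"
  shows "same_up_to_sign A B"
proof -
  obtain p q r s where bc: "basis_change p q r s A B"
    using isomorphic_imp_basis_change[OF iso] .
  then have det: "p * s - q * r \<noteq> 0" by (simp add: basis_change_def)
  note tr = trace_basis_change[OF bc]
  note square = square_normal_forms_basis_change[of r s A B]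
  note line = invariant_line_normal_forms_basis_change[of r s A B, OF _ two]
  from A show ?thesis
  proof (cases rule: ideal_free_shapes)
    case (A1 a b c d)
    from B show ?thesis
    proof (cases rule: ideal_free_shapes)
      case (A1 a' b' c' d')
      with \<open>A = _\<close> tr have "p = 1" "q = 0" "r = 0" "s = 1" by simp_all
      with bc have "A = B" by (simp add: basis_change_iff vec2_eq_iff vec_eq_iff forall_4)
      then show ?thesis by (simp add: same_up_to_sign.intros)
    qed (use \<open>A = _\<close> tr in auto)
  next
    case (A2 a b c)
    from B show ?thesis
    proof (cases rule: ideal_free_shapes)
      case (A1 a' b' c' d')
      with \<open>A = _\<close> tr det show ?thesis by simp
    next
      case (A2 a' b' c')
      with \<open>A = _\<close> tr have "p = 1" "q = 0" by simp_all
      with bc \<open>A = _\<close> A2 square have "a' = a \<and> c' = c \<and> (b' = b \<or> b' = - b)" by simp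
      with \<open>A = _\<close> A2 show ?thesis by (auto intro: same_up_to_sign.intros)
    next
      case (A3 b' c')
      with \<open>A = _\<close> tr have "p = 1" "q = 0" by simp_all
      with bc \<open>A = _\<close> A3 not_basis_change_square_invariant_line[of r s A B a]
        show ?thesis by simp
    qed (use \<open>A = _\<close> tr in auto)
  next
    case (A3 b c)
    from B show ?thesis
    proof (cases rule: ideal_free_shapes)
      case (A1 a' b' c' d')
      with \<open>A = _\<close> tr det show ?thesis by simp
    next
      case (A2 a' b' c')
      with \<open>A = _\<close> tr have "p = 1" "q = 0" by simp_all
      with bc \<open>A = _\<close> A2 not_basis_change_invariant_line_square[of r s A B a']
        show ?thesis by simp
    next
      case (A3 b' c')
      with \<open>A = _\<close> tr have "p = 1" "q = 0" by simp_all
      with bc \<open>A = _\<close> A3 line have "A = B" by simp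
      then show ?thesis by (simp add: same_up_to_sign.intros)
    qed (use \<open>A = _\<close> tr in auto)
  next
    case (A6 a b)
    from B show ?thesis
    proof (cases rule: ideal_free_shapes)
      case (A6 a' b')
      with \<open>A = _\<close> tr have "p = 1" "q = 0" by simp_all
      with bc \<open>A = _\<close> A6 square have "a' = a \<and> (b' = b \<or> b' = - b)" by simp
      with \<open>A = _\<close> A6 show ?thesis by (auto intro: same_up_to_sign.intros)
    next
      case (A7 b')
      with \<open>A = _\<close> tr have "p = 1" "q = 0" by simp_all
      with bc \<open>A = _\<close> A7 not_basis_change_square_invariant_line[of r s A B a]
        show ?thesis by simp
    qed (use \<open>A = _\<close> tr det in auto)
  next
    case (A7 b)
    from B show ?thesis
    proof (cases rule: ideal_free_shapes)
      case (A6 a' b')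
      with \<open>A = _\<close> tr have "p = 1" "q = 0" by simp_all
      with bc \<open>A = _\<close> A6 not_basis_change_invariant_line_square[of r s A B a']
        show ?thesis by simp
    next
      case (A7 b')
      with \<open>A = _\<close> tr have "p = 1" "q = 0" by simp_all
      with bc \<open>A = _\<close> A7 line have "A = B" by simp
      then show ?thesis by (simp add: same_up_to_sign.intros)
    qed (use \<open>A = _\<close> tr det in auto)
  next
    case A11
    from B show ?thesis
    proof (cases rule: ideal_free_shapes)
      case A11': A11
      with A11 show ?thesis by (simp add: same_up_to_sign.intros)
    qed (use \<open>A = _\<close> tr det in auto)
  qed
qed

text \<open>Replacing \<open>e_2\<close> by \<open>- e_2\<close> keeps \<open>e_2 e_2 = e_1\<close>
  and reverses only the sign of the \<open>e_2\<close>-coordinate of \<open>e_1 e_1\<close>.\<close>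

lemma same_imp_isomorphic:
  assumes "same_up_to_sign A (B :: 'a::field^4^2)"
  shows "isomorphic_algebras (*s) (msc_prod A) (*s) (msc_prod B)"
  using assms
proof cases
  case 1
  have "Vector_Spaces.linear (*s) (*s) (id :: 'a^2 \<Rightarrow> 'a^2)"
    by (rule vec.linear_id)
  with 1 show ?thesis
    unfolding isomorphic_algebras_def by (intro exI[of _ id]) simp
next
  case (2 a b c)
  obtain C where iso: "isomorphic_algebras (*s) (msc_prod C) (*s) (msc_prod B)"
    and bc: "basis_change 1 0 0 (- 1) C B"
    using ex_basis_change[of 1 "- 1" 0 0 B] by auto
  have "C = A"
    using bc unfolding 2 basis_change_iff
    by (simp add: vec2_eq_iff vec_eq_iff forall_4 minus_equation_iff[of _ "a - 1"])
  with iso show ?thesis by simp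
next
  case (3 a b)
  obtain C where iso: "isomorphic_algebras (*s) (msc_prod C) (*s) (msc_prod B)"
    and bc: "basis_change 1 0 0 (- 1) C B"
    using ex_basis_change[of 1 "- 1" 0 0 B] by auto
  have "C = A"
    using bc unfolding 3 basis_change_iff
    by (simp add: vec2_eq_iff vec_eq_iff forall_4 minus_equation_iff[of _ a]
        minus_equation_iff[of _ "a - 1"])
  with iso show ?thesis by simp
qed

section \<open>Counting ideals and classifying simple algebras\<close>

lemma ideal_count_A1:
  "\<alpha>4 \<noteq> - \<alpha>1 - 2 * \<alpha>2 \<or> \<beta>1 \<noteq> 2 * \<alpha>1 + \<alpha>2 \<Longrightarrow> msc_ideals (A1 \<alpha>1 \<alpha>2 \<alpha>4 \<beta>1) = {}"
  "\<alpha>4 = - \<alpha>1 - 2 * \<alpha>2 \<and> \<beta>1 = 2 * \<alpha>1 + \<alpha>2 \<Longrightarrow> card (msc_ideals (A1 \<alpha>1 \<alpha>2 \<alpha>4 \<beta>1)) = 1"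
  by (auto simp: msc_ideals_empty_iff spans_ideal_A1 simp del: One_nat_def
      intro: card_msc_ideals_1[of _ 1 1])

lemma ideal_count_A2_none:
  fixes \<alpha>1 :: "'a::field"
  assumes two: "(2::'a) \<noteq> 0" and params: "(\<alpha>1 = 1 \<and> \<beta>1 \<noteq> 0 \<and> \<beta>2 = 0) \<or>
     (\<alpha>1 \<noteq> 1 / 2 \<and> \<alpha>1 \<noteq> 1 \<and> \<beta>1\<^sup>2 + (\<alpha>1 - 1) * (2 * \<alpha>1 - 1)\<^sup>2 \<noteq> 0 \<and> \<beta>2 = 1 - \<alpha>1) \<or>
     (\<alpha>1 = 1 / 2 \<and> \<beta>2 = 1 / 2 \<and> \<beta>1 \<noteq> 0) \<or> \<beta>2 \<noteq> 1 - \<alpha>1"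
  shows "msc_ideals (A2 \<alpha>1 \<beta>1 \<beta>2 :: 'a^4^2) = {}"
proof -
  have False if "spans_ideal (A2 \<alpha>1 \<beta>1 \<beta>2) x y" for x y
  proof -
    from that have x: "x \<noteq> 0" and b2: "\<beta>2 = 1 - \<alpha>1"
      and y: "y\<^sup>2 = (1 - \<alpha>1) * x\<^sup>2" and b1: "\<beta>1 * x = (2 * \<alpha>1 - 1) * y"
      by (simp_all add: spans_ideal_A2)
    \<comment> \<open>Squaring the linear condition and inserting the quadratic one eliminates
      \<open>y\<close>.\<close>
    have "x\<^sup>2 * (\<beta>1\<^sup>2 + (\<alpha>1 - 1) * (2 * \<alpha>1 - 1)\<^sup>2) = 0"
      using y b1 by algebra
    with x have "\<beta>1\<^sup>2 + (\<alpha>1 - 1) * (2 * \<alpha>1 - 1)\<^sup>2 = 0" by simp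
    \<comment> \<open>In both surviving cases the right side of the linear condition vanishes:
      \<open>y = 0\<close> at 1, a zero coefficient at one half.\<close>
    with params b2 have "\<beta>1 \<noteq> 0" and cases: "\<alpha>1 = 1 \<or> \<alpha>1 = 1 / 2" by auto
    from cases have "(2 * \<alpha>1 - 1) * y = 0"
    proof
      assume "\<alpha>1 = 1 / 2"
      with two have "2 * \<alpha>1 - 1 = 0" by (simp add: mult.commute)
      then show ?thesis by simp
    qed (use y in simp)
    with b1 \<open>\<beta>1 \<noteq> 0\<close> x show False by simp
  qed
  then show ?thesis by (auto simp: msc_ideals_empty_iff)
qed

lemma ideal_count_A2_one:
  fixes \<alpha>1 :: "'a::field"
  assumes two: "(2::'a) \<noteq> 0" and params: "(\<alpha>1 = 1 \<and> \<beta>1 = 0 \<and> \<beta>2 = 0) \<or>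
     (\<alpha>1 \<noteq> 1 / 2 \<and> \<alpha>1 \<noteq> 1 \<and> \<beta>2 = 1 - \<alpha>1 \<and> \<beta>1\<^sup>2 + (\<alpha>1 - 1) * (2 * \<alpha>1 - 1)\<^sup>2 = 0)"
  shows "card (msc_ideals (A2 \<alpha>1 \<beta>1 \<beta>2 :: 'a^4^2)) = 1"
proof -
  \<comment> \<open>The linear condition makes \<open>(k, \<beta>1)\<close> the only candidate
    direction.\<close>
  define k where "k = 2 * \<alpha>1 - 1"
  have k: "k \<noteq> 0"
  proof (cases "\<alpha>1 = 1")
    case False
    with params have "\<alpha>1 \<noteq> 1 / 2" by blast
    with two show ?thesis by (simp add: k_def field_simps)
  qed (simp add: k_def)
  have b2: "\<beta>2 = 1 - \<alpha>1" and b1: "\<beta>1\<^sup>2 = (1 - \<alpha>1) * k\<^sup>2"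
    using params by (auto simp: k_def) algebra
  show ?thesis
  proof (rule card_msc_ideals_1)
    show "spans_ideal (A2 \<alpha>1 \<beta>1 \<beta>2) k \<beta>1"
      using k b1 b2 by (simp add: spans_ideal_A2 k_def mult.commute)
  next
    fix x y assume "spans_ideal (A2 \<alpha>1 \<beta>1 \<beta>2) x y"
    then show "x * \<beta>1 = y * k" by (simp add: spans_ideal_A2 k_def mult.commute)
  qed
qed

lemma ideal_count_A2_two:
  fixes \<alpha>1 :: "'a::field"
  assumes two: "(2::'a) \<noteq> 0" and sqrt: "\<And>k :: 'a. \<exists>c. c * c = k"
    and params: "\<alpha>1 = 1 / 2 \<and> \<beta>2 = 1 / 2 \<and> \<beta>1 = 0"
  shows "card (msc_ideals (A2 \<alpha>1 \<beta>1 \<beta>2 :: 'a^4^2)) = 2"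
proof -
  \<comment> \<open>The linear condition is void here, so both slopes \<open>y\<close> and
    \<open>- y\<close> occur; they differ because \<open>2 * y\<close> is nonzero.\<close>
  obtain y where y: "y * y = 1 - \<alpha>1" using sqrt by blast
  have half: "1 - \<alpha>1 = \<alpha>1" "2 * \<alpha>1 = 1" "\<alpha>1 \<noteq> 0"
    using params two by (auto simp: field_simps)
  from y have "y * y = \<alpha>1" by (simp only: half(1))
  with half(3) have y0: "y \<noteq> 0" by auto
  have b2: "\<beta>2 = 1 - \<alpha>1" unfolding half(1) using params by metis
  have iff: "spans_ideal (A2 \<alpha>1 \<beta>1 \<beta>2) u v \<longleftrightarrow> u \<noteq> 0 \<and> v\<^sup>2 = (1 - \<alpha>1) * u\<^sup>2" for u v
    by (simp add: spans_ideal_A2 half(2) b2 conjunct2[OF conjunct2[OF params]])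
  show ?thesis
  proof (rule card_msc_ideals_2)
    show "spans_ideal (A2 \<alpha>1 \<beta>1 \<beta>2) 1 y" "spans_ideal (A2 \<alpha>1 \<beta>1 \<beta>2) 1 (- y)"
      using y by (simp_all add: iff power2_eq_square)
    have "2 * y \<noteq> 0" using y0 two by simp
    then show "1 * - y \<noteq> y * 1" by (simp add: eq_neg_iff_add_eq_0 neg_eq_iff_add_eq_0)
  next
    fix u v assume "spans_ideal (A2 \<alpha>1 \<beta>1 \<beta>2) u v"
    then have "v\<^sup>2 = (1 - \<alpha>1) * u\<^sup>2" by (simp add: iff)
    with y have "(u * y - v * 1) * (u * - y - v * 1) = 0" by algebra
    then show "u * y = v * 1 \<or> u * - y = v * 1" by simp
  qed
qed

lemma ideal_count_A3:
  fixes \<beta>1 :: "'a::field"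
  assumes two: "(2::'a) \<noteq> 0"
  shows "(\<beta>1 \<noteq> - (1 / 4) \<and> \<beta>2 = 1) \<or> \<beta>2 \<noteq> 1 \<Longrightarrow> msc_ideals (A3 \<beta>1 \<beta>2) = {}"
    "\<beta>1 = - (1 / 4) \<and> \<beta>2 = 1 \<Longrightarrow> card (msc_ideals (A3 \<beta>1 \<beta>2)) = 1"
  by (auto simp: msc_ideals_empty_iff spans_ideal_A3[OF two] simp del: One_nat_def
      intro: card_msc_ideals_1[of _ 2 1])

lemma ideal_count_A4:
  "\<alpha>1 \<noteq> 1 \<and> \<beta>2 = 1 - \<alpha>1 \<or> \<beta>2 \<noteq> 1 - \<alpha>1 \<Longrightarrow> card (msc_ideals (A4 \<alpha>1 \<beta>2)) = 1"
  "\<alpha>1 = 1 \<and> \<beta>2 = 0 \<Longrightarrow> card (msc_ideals (A4 \<alpha>1 \<beta>2)) = 2"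
  by (auto simp: spans_ideal_A4 simp del: One_nat_def
      intro!: card_msc_ideals_1[of _ 0 1] card_msc_ideals_2[of _ 0 1 1 0])

lemma ideal_count_A5: "card (msc_ideals (A5 \<alpha>1)) = 1"
  by (rule card_msc_ideals_1[of _ 0 1]) (simp_all add: spans_ideal_A5)

lemma ideal_count_A8: "card (msc_ideals (A8 \<alpha>1)) = 1"
  by (rule card_msc_ideals_1[of _ 0 1]) (simp_all add: spans_ideal_A8)

lemma ideal_count_A9:
  assumes "(3::'a::field) \<noteq> 0"
  shows "card (msc_ideals (A9 :: 'a^4^2)) = 1"
  by (rule card_msc_ideals_1[of _ 0 1]) (simp_all add: spans_ideal_A9[OF assms])

lemma ideal_count_A12: "card (msc_ideals A12) = 1"
  by (rule card_msc_ideals_1[of _ 0 1]) (simp_all add: spans_ideal_A12)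
lemma ideal_count_A10: "card (msc_ideals A10) = 1"
  by (rule card_msc_ideals_1[of _ 1 0]) (simp_all add: spans_ideal_A10)

lemma ideal_count_A6: "msc_ideals (A6 \<alpha>1 \<beta>1) = {}"
  by (simp add: msc_ideals_empty_iff spans_ideal_A6)

lemma ideal_count_A7: "msc_ideals (A7 \<beta>1) = {}"
  by (simp add: msc_ideals_empty_iff spans_ideal_A7)

lemma ideal_count_A11:
  assumes "(2::'a::field) \<noteq> 0"
  shows "msc_ideals (A11 :: 'a^4^2) = {}"
  by (simp add: msc_ideals_empty_iff spans_ideal_A11[OF assms])

lemma ideal_free_imp_simple:
  fixes A :: "'a::field^4^2"
  assumes two: "(2::'a) \<noteq> 0" and A: "ideal_free A"
  shows "simple_algebra (*s) (msc_prod A)"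
proof -
  have "msc_ideals A = {}"
    using A
  proof cases
    case (1 \<alpha>4 \<alpha>1 \<alpha>2 \<beta>1)
    then show ?thesis using ideal_count_A1(1) by blast
  next
    case (2 \<alpha>1 \<beta>1 \<beta>2)
    then show ?thesis using ideal_count_A2_none[OF two, of \<alpha>1 \<beta>1 \<beta>2] by blast
  next
    case (3 \<alpha>1 \<beta>1 \<beta>2)
    then show ?thesis using ideal_count_A2_none[OF two, of \<alpha>1 \<beta>1 \<beta>2] by blast
  next
    case (4 \<alpha>1 \<beta>2 \<beta>1)
    then show ?thesis using ideal_count_A2_none[OF two, of \<alpha>1 \<beta>1 \<beta>2] by blast
  next
    case (5 \<beta>2 \<alpha>1 \<beta>1)
    then show ?thesis using ideal_count_A2_none[OF two, of \<alpha>1 \<beta>1 \<beta>2] by blast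
  next
    case (6 \<beta>1 \<beta>2)
    then show ?thesis using ideal_count_A3(1)[OF two] by blast
  qed (simp_all add: ideal_count_A6 ideal_count_A7 ideal_count_A11[OF two])
  moreover have "\<exists>x y. msc_prod A x y \<noteq> 0"
  proof (rule ccontr)
    assume "\<not> (\<exists>x y. msc_prod A x y \<noteq> 0)"
    then have "msc_prod A x y = 0" for x y by blast
    \<comment> \<open>A zero product would make every line an ideal.\<close>
    then have "spans_ideal A 1 0"
      using spans_ideal_iff[of A "vector [1, 0]"] vec.span_zero
        vec2_eq_iff[of "vector [1, 0] :: 'a^2" 0] by simp
    with \<open>msc_ideals A = {}\<close> show False by (simp add: msc_ideals_empty_iff)
  qed
  ultimately show ?thesis
    using two_dim_algebra_msc unfolding simple_algebra_def by blast
qed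

lemma simple_imp_isomorphic_msc:
  fixes s :: "'a::field \<Rightarrow> 'v::ab_group_add \<Rightarrow> 'v"
  assumes "simple_algebra s m"
  obtains A :: "'a^4^2" where "isomorphic_algebras (*s) (msc_prod A) s m" "msc_ideals A = {}"
proof -
  from assms have dim: "vector_space s" "vector_space.dim s UNIV = 2"
    and lin: "\<And>x. Vector_Spaces.linear s s (\<lambda>y. m x y)" "\<And>y. Vector_Spaces.linear s s (\<lambda>x. m x y)"
    and none: "nontrivial_ideals s m = {}"
    unfolding simple_algebra_def two_dim_algebra_def by blast+
  obtain f :: "'a^2 \<Rightarrow> 'v" where f: "Vector_Spaces.linear (*s) s f" "bij f"
    using two_dim_algebra_coordinates[OF dim] .
  show ?thesis
  proof (rule ex_msc_isomorphic[OF lin f])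
    fix A :: "'a^4^2" assume iso: "isomorphic_algebras (*s) (msc_prod A) s m"
    show ?thesis by (rule that[OF iso isomorphic_algebras_ideals_empty[OF iso none]])
  qed
qed

theorem mainTheorem5:
  assumes char2: "CHAR('a::field) \<noteq> 2" and char3: "CHAR('a) \<noteq> 3"
    and roots: "\<And>p :: 'a poly. degree p = 2 \<or> degree p = 3 \<Longrightarrow> \<exists>x. poly p x = 0"
  shows
    "(\<forall>\<alpha>1 \<alpha>2 \<alpha>4 \<beta>1 :: 'a.
        (\<alpha>4 \<noteq> - \<alpha>1 - 2 * \<alpha>2 \<or> \<beta>1 \<noteq> 2 * \<alpha>1 + \<alpha>2 \<longrightarrow> msc_ideals (A1 \<alpha>1 \<alpha>2 \<alpha>4 \<beta>1) = {}) \<and>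
        (\<alpha>4 = - \<alpha>1 - 2 * \<alpha>2 \<and> \<beta>1 = 2 * \<alpha>1 + \<alpha>2 \<longrightarrow> card (msc_ideals (A1 \<alpha>1 \<alpha>2 \<alpha>4 \<beta>1)) = 1)) \<and>
     (\<forall>\<alpha>1 \<beta>1 \<beta>2 :: 'a.
        ((\<alpha>1 = 1 \<and> \<beta>1 \<noteq> 0 \<and> \<beta>2 = 0) \<or>
         (\<alpha>1 \<noteq> 1 / 2 \<and> \<alpha>1 \<noteq> 1 \<and> \<beta>1\<^sup>2 + (\<alpha>1 - 1) * (2 * \<alpha>1 - 1)\<^sup>2 \<noteq> 0 \<and> \<beta>2 = 1 - \<alpha>1) \<or>
         (\<alpha>1 = 1 / 2 \<and> \<beta>2 = 1 / 2 \<and> \<beta>1 \<noteq> 0) \<or>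
         \<beta>2 \<noteq> 1 - \<alpha>1 \<longrightarrow> msc_ideals (A2 \<alpha>1 \<beta>1 \<beta>2) = {}) \<and>
        ((\<alpha>1 = 1 \<and> \<beta>1 = 0 \<and> \<beta>2 = 0) \<or>
         (\<alpha>1 \<noteq> 1 / 2 \<and> \<alpha>1 \<noteq> 1 \<and> \<beta>2 = 1 - \<alpha>1 \<and> \<beta>1\<^sup>2 + (\<alpha>1 - 1) * (2 * \<alpha>1 - 1)\<^sup>2 = 0)
           \<longrightarrow> card (msc_ideals (A2 \<alpha>1 \<beta>1 \<beta>2)) = 1) \<and>
        (\<alpha>1 = 1 / 2 \<and> \<beta>2 = 1 / 2 \<and> \<beta>1 = 0 \<longrightarrow> card (msc_ideals (A2 \<alpha>1 \<beta>1 \<beta>2)) = 2)) \<and>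
     (\<forall>\<beta>1 \<beta>2 :: 'a.
        ((\<beta>1 \<noteq> - (1 / 4) \<and> \<beta>2 = 1) \<or> \<beta>2 \<noteq> 1 \<longrightarrow> msc_ideals (A3 \<beta>1 \<beta>2) = {}) \<and>
        (\<beta>1 = - (1 / 4) \<and> \<beta>2 = 1 \<longrightarrow> card (msc_ideals (A3 \<beta>1 \<beta>2)) = 1)) \<and>
     (\<forall>\<alpha>1 \<beta>2 :: 'a.
        ((\<alpha>1 \<noteq> 1 \<and> \<beta>2 = 1 - \<alpha>1) \<or> \<beta>2 \<noteq> 1 - \<alpha>1 \<longrightarrow> card (msc_ideals (A4 \<alpha>1 \<beta>2)) = 1) \<and>
        (\<alpha>1 = 1 \<and> \<beta>2 = 0 \<longrightarrow> card (msc_ideals (A4 \<alpha>1 \<beta>2)) = 2)) \<and>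
     (\<forall>\<alpha>1 :: 'a. card (msc_ideals (A5 \<alpha>1)) = 1) \<and>
     (\<forall>\<alpha>1 :: 'a. card (msc_ideals (A8 \<alpha>1)) = 1) \<and>
     card (msc_ideals (A9 :: 'a^4^2)) = 1 \<and>
     card (msc_ideals (A10 :: 'a^4^2)) = 1 \<and>
     card (msc_ideals (A12 :: 'a^4^2)) = 1 \<and>
     (\<forall>\<alpha>1 \<beta>1 :: 'a. msc_ideals (A6 \<alpha>1 \<beta>1) = {}) \<and>
     (\<forall>\<beta>1 :: 'a. msc_ideals (A7 \<beta>1) = {}) \<and>
     msc_ideals (A11 :: 'a^4^2) = {} \<and>
     (\<forall>A :: 'a^4^2. ideal_free A \<longrightarrow> simple_algebra (*s) (msc_prod A)) \<and>
     (\<forall>(s :: 'a \<Rightarrow> 'v::ab_group_add \<Rightarrow> 'v) m. simple_algebra s m \<longrightarrow>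
        (\<exists>A. ideal_free A \<and> isomorphic_algebras s m (*s) (msc_prod A))) \<and>
     (\<forall>A B :: 'a^4^2. ideal_free A \<and> ideal_free B \<longrightarrow>
        (isomorphic_algebras (*s) (msc_prod A) (*s) (msc_prod B) \<longleftrightarrow> same_up_to_sign A B))"
proof -
  \<comment> \<open>If 2 or 3 vanished, the characteristic would divide that prime; it is not 1, so
    it would be the prime itself.\<close>
  have "of_nat 2 \<noteq> (0::'a)" "of_nat 3 \<noteq> (0::'a)"
    unfolding of_nat_eq_0_iff_char_dvd
    using char2 char3 CHAR_not_1[where 'a = 'a] prime_nat_iff[of 2] prime_nat_iff[of 3] by auto
  then have two: "(2::'a) \<noteq> 0" and three: "(3::'a) \<noteq> 0" by simp_all
  have sqrt: "\<exists>c. c * c = k" for k :: 'a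
    using roots[of "[:- k, 0, 1:]"] by (auto simp: eq_neg_iff_add_eq_0)
  have cubic: "\<exists>t. a * t ^ 3 + b * t ^ 2 + c * t + d = 0" if "a \<noteq> 0" for a b c d :: 'a
    using roots[of "[:d, c, b, a:]"] that
    by (auto simp: algebra_simps power2_eq_square power3_eq_cube)
  have classify: "\<exists>A. ideal_free A \<and> isomorphic_algebras s m (*s) (msc_prod A)"
    if "simple_algebra s m" for s :: "'a \<Rightarrow> 'v::ab_group_add \<Rightarrow> 'v" and m
  proof -
    obtain A :: "'a^4^2" where "isomorphic_algebras (*s) (msc_prod A) s m" "msc_ideals A = {}"
      using simple_imp_isomorphic_msc[OF \<open>simple_algebra s m\<close>] .
    moreover obtain B where "ideal_free B"
      "isomorphic_algebras (*s) (msc_prod B) (*s) (msc_prod A)"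
      using classification[OF two sqrt cubic] \<open>msc_ideals A = {}\<close> by blast
    ultimately show ?thesis
      using isomorphic_algebras_sym isomorphic_algebras_trans by blast
  qed
  have same: "isomorphic_algebras (*s) (msc_prod A) (*s) (msc_prod B) \<longleftrightarrow> same_up_to_sign A B"
    if "ideal_free A \<and> ideal_free B" for A B :: "'a^4^2"
    using isomorphic_imp_same[OF two] same_imp_isomorphic that by blast
  show ?thesis
    by (intro conjI allI impI)
      (erule ideal_count_A1 ideal_count_A2_none[OF two] ideal_count_A2_one[OF two]
          ideal_count_A2_two[OF two sqrt] ideal_count_A3[OF two] ideal_count_A4
          ideal_free_imp_simple[OF two] classify same |
        rule ideal_count_A5 ideal_count_A8 ideal_count_A9[OF three] ideal_count_A10
          ideal_count_A12 ideal_count_A6 ideal_count_A7 ideal_count_A11[OF two])+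
qed

end
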